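(* Let $(A_0,A_1)$ be a Banach couple over $\mathbb{F}\in\{\mathbb{R},\mathbb{C}\}$, let $\theta\in(0,1)$ and let $r>0$. Then the spaces $\langle A_0,A_1\rangle_{\theta,(r)}$ and $\langle A_0,A_1\rangle_{\theta,(0)}$ coincide (as subspaces of $A_0+A_1$) to within equivalence of norms. More explicitly, their norms satisfy $$e^{-r\theta}\,\|a\|_{\langle A_0,A_1\rangle_{\theta,(r)}}\le \|a\|_{\langle A_0,A_1\rangle_{\theta,(0)}}\le e^{(1-\theta)r}\,\|a\|_{\langle A_0,A_1\rangle_{\theta,(r)}}\quad\text{for all } a\in\langle A_0,A_1\rangle_{\theta,(0)}.$$
   Context: A Banach couple $(A_0,A_1)$ consists of two Banach spaces over the same field $\mathbb{F}$ continuously embedded in a common Hausdorff topological vector space. $A_0\cap A_1$ is normed by $\max\{\|a\|_{A_0},\|a\|_{A_1}\}$ and $A_0+A_1$ by $\inf\{\|a_0\|_{A_0}+\|a_1\|_{A_1}: a=a_0+a_1\}$. Discrete definition ($r>0$). Let $\Lambda$ be the set of all scalar sequences $\{\lambda_k\}_{k\in\mathbb{Z}}$ with $\sup_k|\lambda_k|\le1$. A series $\sum_{n\in\mathbb{Z}}x_n$ in a Banach space $A$ is unconditionally convergent if for every bounded scalar sequence $\{\lambda_n\}_{n\in\mathbb{Z}}$ the partial sums $\sum_{n=-N}^N\lambda_nx_n$ converge in norm in $A$ as $N\to\infty$. $J(\theta,r,A_0,A_1)$ is the space of all sequences $\{a_n\}_{n\in\mathbb{Z}}$ in $A_0\cap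 A_1$ such that $\sum_{n\in\mathbb{Z}}e^{(j-\theta)rn}a_n$ is unconditionally convergent in $A_j$ for $j=0$ and $j=1$, with norm $$\|\{a_n\}\|_{J(\theta,r,A_0,A_1)}=\sup\Big\{\Big\|\sum_{n=-\infty}^\infty\lambda_ne^{(j-\theta)rn}a_n\Big\|_{A_j}: j\in\{0,1\},\ \{\lambda_k\}\in\Lambda\Big\},$$ which is finite. For each such sequence, $\sum_{n=-\infty}^\infty a_n:=\lim_{N\to\infty}\sum_{n=-N}^{N}a_n$ exists in the norm of $A_0+A_1$. $\langle A_0,A_1\rangle_{\theta,(r)}$ is the space of all $a\in A_0+A_1$ of the form $a=\sum_{n=-\infty}^\infty a_n$ with $\{a_n\}\in J(\theta,r,A_0,A_1)$, normed by the infimum of $\|\{a_n\}\|_{J(\theta,r,A_0,A_1)}$ over all such representations. Continuous definition ($r=0$). A function on $\mathbb{R}$ is locally piecewise continuous if it is piecewise continuous on every bounded interval. Let $\Phi$ be the set of all locally piecewise continuous $\phi:\mathbb{R}\to\mathbb{F}$ with $\sup_{t}|\phi(t)|\le1$. Let $J$ (also written $J(\theta,A_0,A_1)$) be the space of all locally piecewise continuous $u:\mathbb{R}\to A_0\cap A_1$ such that, for $j=0$ and $j=1$ and every $\phi\in\Phi$, the Riemann integrals $\int_{-R}^Re^{(j-\theta)t}\phi(t)u(t)\,dt$ converge in the norm of $A_j$ as $R\to+\infty$; the limit is denoted $\int_{-\infty}^\infty e^{(j-\theta)t}\phi(t)u(t)\,dt$. $J$ carries the (finite) seminorm $$\|u\|_J=\sup\Big\{\Big\|\int_{-\infty}^\infty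 e^{(j-\theta)t}\phi(t)u(t)\,dt\Big\|_{A_j}: j\in\{0,1\},\ \phi\in\Phi\Big\}.$$ For $u\in J$, $\int_{-\infty}^\infty u(t)\,dt:=\lim_{R\to+\infty}\int_{-R}^{R}u(t)\,dt$ exists in the norm of $A_0+A_1$. $\langle A_0,A_1\rangle_{\theta,(0)}$ is the space of all $a\in A_0+A_1$ of the form $a=\int_{-\infty}^\infty u(t)\,dt$ with $u\in J$, normed by the infimum of $\|u\|_J$ over all such $u$. *)

theory Defs
  imports "HOL-Analysis.Analysis"
begin

section \<open>The scalar field\<close>

text \<open>A normed field whose elements are all of the form a + b i with a, b real and either i = 0
  or i * i = -1, i.e. the reals or the complex numbers. Multiplicativity of the norm
  forces it to be the usual absolute value.\<close>

class real_or_complex = real_normed_field + banach +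
  assumes real_or_complex_basis:
    "\<exists>i. (i = 0 \<or> i * i = -1) \<and> (\<forall>z. \<exists>a b. z = a *\<^sub>R 1 + b *\<^sub>R i)"

instance real :: real_or_complex
proof
  show "\<exists>i::real. (i = 0 \<or> i * i = -1) \<and> (\<forall>z. \<exists>a b. z = a *\<^sub>R 1 + b *\<^sub>R i)"
    by (intro exI[of _ 0]) auto
qed

instance complex :: real_or_complex
proof
  have "z = Re z *\<^sub>R 1 + Im z *\<^sub>R \<i>" for z
    by (simp add: complex_eq_iff)
  then have "\<forall>z. \<exists>a b. z = a *\<^sub>R 1 + b *\<^sub>R \<i>"
    by blast
  moreover have "\<i> * \<i> = -1"
    by simp
  ultimately show "\<exists>i::complex. (i = 0 \<or> i * i = -1) \<and> (\<forall>z. \<exists>a b. z = a *\<^sub>R 1 + b *\<^sub>R i)"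
    by blast
qed


section \<open>Banach couples\<close>

locale banach_space_over = vector_space scale
  for scale :: "'f::real_or_complex \<Rightarrow> 'a::banach \<Rightarrow> 'a" +
  assumes scale_of_real: "\<And>c x. scale (of_real c) x = c *\<^sub>R x"
    and norm_scale: "\<And>c x. norm (scale c x) = norm c * norm x"

locale hausdorff_tvs = vector_space scale
  for scale :: "'f::real_or_complex \<Rightarrow> 'x::{topological_ab_group_add, t2_space} \<Rightarrow> 'x" +
  assumes continuous_scale: "continuous_on UNIV (\<lambda>(c, x). scale c x)"

text \<open>The spaces \<open>A\<^sub>0\<close> and \<open>A\<^sub>1\<close> are the types \<open>'a\<close> and \<open>'b\<close>; they are regarded as
  subspaces of the ambient space through the embeddings \<open>i0\<close> and \<open>i1\<close>.\<close>

locale banach_couple =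
  A0: banach_space_over s0 + A1: banach_space_over s1 + X: hausdorff_tvs sX
  for s0 :: "'f::real_or_complex \<Rightarrow> 'a::banach \<Rightarrow> 'a"
    and s1 :: "'f \<Rightarrow> 'b::banach \<Rightarrow> 'b"
    and sX :: "'f \<Rightarrow> 'x::{topological_ab_group_add, t2_space} \<Rightarrow> 'x"
    and i0 :: "'a \<Rightarrow> 'x"
    and i1 :: "'b \<Rightarrow> 'x" +
  assumes linear_i0: "Vector_Spaces.linear s0 sX i0"
    and linear_i1: "Vector_Spaces.linear s1 sX i1"
    and inj_i0: "inj i0"
    and inj_i1: "inj i1"
    and continuous_i0: "continuous_on UNIV i0"
    and continuous_i1: "continuous_on UNIV i1"

text \<open>An element of \<open>A\<^sub>0 \<inter> A\<^sub>1\<close> is a pair consisting of its incarnations in \<open>A\<^sub>0\<close> and \<open>A\<^sub>1\<close>.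
  The maximum of the two norms is equivalent to the norm of the product type, so continuity,
  limits and integrals in \<open>A\<^sub>0 \<inter> A\<^sub>1\<close> are those of the product type (in which the intersection
  is closed).\<close>

definition couple_inter :: "('a \<Rightarrow> 'x) \<Rightarrow> ('b \<Rightarrow> 'x) \<Rightarrow> ('a \<times> 'b) set" where
  "couple_inter i0 i1 = {p. i0 (fst p) = i1 (snd p)}"

definition couple_sum :: "('a \<Rightarrow> 'x::plus) \<Rightarrow> ('b \<Rightarrow> 'x) \<Rightarrow> 'x set" where
  "couple_sum i0 i1 = {i0 x + i1 y | x y. True}"

definition couple_sum_norm ::
    "('a::real_normed_vector \<Rightarrow> 'x::plus) \<Rightarrow> ('b::real_normed_vector \<Rightarrow> 'x) \<Rightarrow> 'x \<Rightarrow> real" where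
  "couple_sum_norm i0 i1 a = Inf {norm x + norm y | x y. a = i0 x + i1 y}"


section \<open>The discrete spaces\<close>

definition sym_partial_sum :: "(int \<Rightarrow> 'a::comm_monoid_add) \<Rightarrow> nat \<Rightarrow> 'a" where
  "sym_partial_sum x N = (\<Sum>n = - int N..int N. x n)"

definition unconditionally_convergent ::
    "('f::real_normed_vector \<Rightarrow> 'a \<Rightarrow> 'a) \<Rightarrow> (int \<Rightarrow> 'a::real_normed_vector) \<Rightarrow> bool" where
  "unconditionally_convergent s x \<longleftrightarrow>
     (\<forall>l. bounded (range l) \<longrightarrow> convergent (sym_partial_sum (\<lambda>n. s (l n) (x n))))"

definition unit_seqs :: "(int \<Rightarrow> 'f::real_normed_vector) set" where
  "unit_seqs = {l. \<forall>k. norm (l k) \<le> 1}"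

definition J_disc ::
    "('f::real_or_complex \<Rightarrow> 'a \<Rightarrow> 'a) \<Rightarrow> ('f \<Rightarrow> 'b \<Rightarrow> 'b) \<Rightarrow> ('a::banach \<Rightarrow> 'x) \<Rightarrow> ('b::banach \<Rightarrow> 'x)
      \<Rightarrow> real \<Rightarrow> real \<Rightarrow> (int \<Rightarrow> 'a \<times> 'b) set" where
  "J_disc s0 s1 i0 i1 \<theta> r = {a.
     range a \<subseteq> couple_inter i0 i1 \<and>
     unconditionally_convergent s0 (\<lambda>n. exp ((0 - \<theta>) * r * of_int n) *\<^sub>R fst (a n)) \<and>
     unconditionally_convergent s1 (\<lambda>n. exp ((1 - \<theta>) * r * of_int n) *\<^sub>R snd (a n))}"

text \<open>The supremum here, and the one in \<open>J_cont_norm\<close>, is over a set that is bounded above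
  for elements of \<open>J_disc\<close> (respectively \<open>J_cont\<close>), so the real-valued \<open>Sup\<close> is the
  intended one.\<close>

definition J_disc_norm ::
    "('f::real_or_complex \<Rightarrow> 'a \<Rightarrow> 'a) \<Rightarrow> ('f \<Rightarrow> 'b \<Rightarrow> 'b)
      \<Rightarrow> real \<Rightarrow> real \<Rightarrow> (int \<Rightarrow> 'a::banach \<times> 'b::banach) \<Rightarrow> real" where
  "J_disc_norm s0 s1 \<theta> r a = Sup (
     (\<lambda>l. norm (lim (sym_partial_sum
        (\<lambda>n. s0 (l n) (exp ((0 - \<theta>) * r * of_int n) *\<^sub>R fst (a n)))))) ` unit_seqs \<union>
     (\<lambda>l. norm (lim (sym_partial_sum
        (\<lambda>n. s1 (l n) (exp ((1 - \<theta>) * r * of_int n) *\<^sub>R snd (a n)))))) ` unit_seqs)"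

text \<open>\<open>disc_rep i0 i1 a x\<close>: the series of the \<open>a n\<close> converges to \<open>x\<close> in the norm
  of \<open>A\<^sub>0 + A\<^sub>1\<close>. A point \<open>p\<close> of the intersection, as an element of the sum, is
  \<open>i0 (fst p) = i1 (snd p)\<close>.\<close>

definition disc_rep ::
    "('a::banach \<Rightarrow> 'x::ab_group_add) \<Rightarrow> ('b::banach \<Rightarrow> 'x) \<Rightarrow> (int \<Rightarrow> 'a \<times> 'b) \<Rightarrow> 'x \<Rightarrow> bool" where
  "disc_rep i0 i1 a x \<longleftrightarrow> x \<in> couple_sum i0 i1 \<and>
     (\<lambda>N. couple_sum_norm i0 i1 (i0 (fst (sym_partial_sum a N)) - x)) \<longlonglongrightarrow> 0"

definition interp_disc ::
    "('f::real_or_complex \<Rightarrow> 'a \<Rightarrow> 'a) \<Rightarrow> ('f \<Rightarrow> 'b \<Rightarrow> 'b)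
      \<Rightarrow> ('a::banach \<Rightarrow> 'x::ab_group_add) \<Rightarrow> ('b::banach \<Rightarrow> 'x) \<Rightarrow> real \<Rightarrow> real \<Rightarrow> 'x set" where
  "interp_disc s0 s1 i0 i1 \<theta> r = {x. \<exists>a \<in> J_disc s0 s1 i0 i1 \<theta> r. disc_rep i0 i1 a x}"

definition interp_disc_norm ::
    "('f::real_or_complex \<Rightarrow> 'a \<Rightarrow> 'a) \<Rightarrow> ('f \<Rightarrow> 'b \<Rightarrow> 'b)
      \<Rightarrow> ('a::banach \<Rightarrow> 'x::ab_group_add) \<Rightarrow> ('b::banach \<Rightarrow> 'x) \<Rightarrow> real \<Rightarrow> real \<Rightarrow> 'x \<Rightarrow> real" where
  "interp_disc_norm s0 s1 i0 i1 \<theta> r x =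
     Inf {J_disc_norm s0 s1 \<theta> r a | a. a \<in> J_disc s0 s1 i0 i1 \<theta> r \<and> disc_rep i0 i1 a x}"


section \<open>The continuous space\<close>

definition piecewise_continuous_on_Icc :: "real \<Rightarrow> real \<Rightarrow> (real \<Rightarrow> 'a::topological_space) \<Rightarrow> bool" where
  "piecewise_continuous_on_Icc a b f \<longleftrightarrow>
     (\<exists>S. finite S \<and> continuous_on ({a..b} - S) f \<and>
       (\<forall>t\<in>{a<..b}. \<exists>l. (f \<longlongrightarrow> l) (at_left t)) \<and>
       (\<forall>t\<in>{a..<b}. \<exists>l. (f \<longlongrightarrow> l) (at_right t)))"

definition locally_piecewise_continuous :: "(real \<Rightarrow> 'a::topological_space) \<Rightarrow> bool" where
  "locally_piecewise_continuous f \<longleftrightarrow> (\<forall>a b. a < b \<longrightarrow> piecewise_continuous_on_Icc a b f)"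

definition unit_funs :: "(real \<Rightarrow> 'f::real_normed_vector) set" where
  "unit_funs = {\<phi>. locally_piecewise_continuous \<phi> \<and> (\<forall>t. norm (\<phi> t) \<le> 1)}"

text \<open>All integrands below are piecewise continuous on bounded intervals, where the
  Henstock-Kurzweil integral of the library is the Riemann integral.\<close>

definition sym_integral :: "(real \<Rightarrow> 'a::banach) \<Rightarrow> real \<Rightarrow> 'a" where
  "sym_integral f R = integral {-R..R} f"

definition J_cont ::
    "('f::real_or_complex \<Rightarrow> 'a \<Rightarrow> 'a) \<Rightarrow> ('f \<Rightarrow> 'b \<Rightarrow> 'b) \<Rightarrow> ('a::banach \<Rightarrow> 'x) \<Rightarrow> ('b::banach \<Rightarrow> 'x)
      \<Rightarrow> real \<Rightarrow> (real \<Rightarrow> 'a \<times> 'b) set" where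
  "J_cont s0 s1 i0 i1 \<theta> = {u.
     range u \<subseteq> couple_inter i0 i1 \<and> locally_piecewise_continuous u \<and>
     (\<forall>\<phi>\<in>unit_funs.
       (\<exists>l. (sym_integral (\<lambda>t. exp ((0 - \<theta>) * t) *\<^sub>R s0 (\<phi> t) (fst (u t))) \<longlongrightarrow> l) at_top) \<and>
       (\<exists>l. (sym_integral (\<lambda>t. exp ((1 - \<theta>) * t) *\<^sub>R s1 (\<phi> t) (snd (u t))) \<longlongrightarrow> l) at_top))}"

definition J_cont_norm ::
    "('f::real_or_complex \<Rightarrow> 'a \<Rightarrow> 'a) \<Rightarrow> ('f \<Rightarrow> 'b \<Rightarrow> 'b)
      \<Rightarrow> real \<Rightarrow> (real \<Rightarrow> 'a::banach \<times> 'b::banach) \<Rightarrow> real" where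
  "J_cont_norm s0 s1 \<theta> u = Sup (
     (\<lambda>\<phi>. norm (Lim at_top (sym_integral
        (\<lambda>t. exp ((0 - \<theta>) * t) *\<^sub>R s0 (\<phi> t) (fst (u t)))))) ` unit_funs \<union>
     (\<lambda>\<phi>. norm (Lim at_top (sym_integral
        (\<lambda>t. exp ((1 - \<theta>) * t) *\<^sub>R s1 (\<phi> t) (snd (u t)))))) ` unit_funs)"

definition cont_rep ::
    "('a::banach \<Rightarrow> 'x::ab_group_add) \<Rightarrow> ('b::banach \<Rightarrow> 'x) \<Rightarrow> (real \<Rightarrow> 'a \<times> 'b) \<Rightarrow> 'x \<Rightarrow> bool" where
  "cont_rep i0 i1 u x \<longleftrightarrow> x \<in> couple_sum i0 i1 \<and>
     ((\<lambda>R. couple_sum_norm i0 i1 (i0 (fst (sym_integral u R)) - x)) \<longlongrightarrow> 0) at_top"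

definition interp_cont ::
    "('f::real_or_complex \<Rightarrow> 'a \<Rightarrow> 'a) \<Rightarrow> ('f \<Rightarrow> 'b \<Rightarrow> 'b)
      \<Rightarrow> ('a::banach \<Rightarrow> 'x::ab_group_add) \<Rightarrow> ('b::banach \<Rightarrow> 'x) \<Rightarrow> real \<Rightarrow> 'x set" where
  "interp_cont s0 s1 i0 i1 \<theta> = {x. \<exists>u \<in> J_cont s0 s1 i0 i1 \<theta>. cont_rep i0 i1 u x}"

definition interp_cont_norm ::
    "('f::real_or_complex \<Rightarrow> 'a \<Rightarrow> 'a) \<Rightarrow> ('f \<Rightarrow> 'b \<Rightarrow> 'b)
      \<Rightarrow> ('a::banach \<Rightarrow> 'x::ab_group_add) \<Rightarrow> ('b::banach \<Rightarrow> 'x) \<Rightarrow> real \<Rightarrow> 'x \<Rightarrow> real" where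
  "interp_cont_norm s0 s1 i0 i1 \<theta> x =
     Inf {J_cont_norm s0 s1 \<theta> u | u. u \<in> J_cont s0 s1 i0 i1 \<theta> \<and> cont_rep i0 i1 u x}"

end

theory Submission
  imports Defs
begin

text \<open>A sequence \<open>a\<close> gives the function equal to \<open>a n / r\<close> on \<open>[nr, (n+1)r)\<close>, and a function \<open>u\<close>
  gives the sequence of its integrals over these intervals. Either way a multiplier for one side
  becomes a multiplier for the other, up to the factors \<open>exp (\<theta> r)\<close> and \<open>exp ((1 - \<theta>) r)\<close> by which the
  weights \<open>exp ((j - \<theta>) t)\<close> vary over an interval of length \<open>r\<close>. That the suprema defining the norms are
  finite is a gliding hump argument: multipliers with large contributions on successive annuli
  \<open>R < |t| \<le> R'\<close> could be glued to one whose integral diverges.\<close>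

section \<open>Piecewise continuous functions\<close>

text \<open>Block \<open>n\<close> starts at \<open>n * r\<close>, so the weight at a point
  \<open>t\<close> of it is the weight at the left end times \<open>exp (c * (t - n * r))\<close>,
  where \<open>c\<close> is -\<theta> or 1 - \<theta> and \<open>t - n * r\<close> lies between 0
  and \<open>r\<close>. Passing from functions to sequences divides by this factor: it costs
  \<open>exp (\<theta> * r)\<close> in the first space and nothing in the second. Passing back
  multiplies by it: nothing in the first space, \<open>exp ((1 - \<theta>) * r)\<close> in the
  second. Hence two different constants. The obstacle is at the ends. The indices from -N to N fill
  [-N r, (N + 1) r], which is not symmetric, and the limit in \<open>R\<close> does not run through
  multiples of \<open>r\<close> only. The boundary blocks must tend to 0. With weights this follows
  by switching multipliers off on a half-line. In the sum of the spaces, without weights, the left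
  end is small only in the first space and the right end only in the second, so the two are
  estimated in different norms. The gliding hump is run for functions only; sequences inherit the
  bound, since the block integrals of a step function give back the sequence.\<close>

text \<open>A local, one-sided form of piecewise continuity without an exceptional set. Nothing is
  asked at the limit point itself, so gluing and products can be checked filter by filter.\<close>

definition continuous_towards :: "'a::t2_space filter \<Rightarrow> ('a \<Rightarrow> 'b::t2_space) \<Rightarrow> bool" where
  "continuous_towards F f \<longleftrightarrow> (\<exists>l. (f \<longlongrightarrow> l) F) \<and> (\<forall>\<^sub>F x in F. isCont f x)"

text \<open>\<open>isCont\<close> looks at full neighbourhoods, whereas a one-sided filter sees one
  side of \<open>t\<close> only. Since \<open>S\<close> is open, every nearby point of
  \<open>S\<close> other than \<open>t\<close> has a full neighbourhood inside \<open>S\<close> that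
  avoids \<open>t\<close>.\<close>

lemma eventually_nhds_within_open:
  fixes t :: "'a::t2_space"
  assumes "open S" "\<forall>\<^sub>F x in at t within S. P x"
  shows "\<forall>\<^sub>F x in at t within S. \<forall>\<^sub>F y in nhds x. P y"
proof -
  obtain U where U: "open U" "t \<in> U" "\<And>x. x \<in> U \<Longrightarrow> x \<noteq> t \<Longrightarrow> x \<in> S \<Longrightarrow> P x"
    using assms(2) unfolding eventually_at_topological by blast
  have "\<forall>\<^sub>F y in nhds x. P y" if "x \<in> U" "x \<noteq> t" "x \<in> S" for x
    unfolding eventually_nhds using that U assms(1)
    by (intro exI[of _ "(U \<inter> S) - {t}"]) (auto intro: open_Diff open_Int)
  then show ?thesis
    unfolding eventually_at_topological using U by blast
qed

lemma continuous_towards_cong: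
  fixes t :: "'a::t2_space"
  assumes "open S" "\<forall>\<^sub>F x in at t within S. f x = g x" "continuous_towards (at t within S) g"
  shows "continuous_towards (at t within S) f"
proof -
  have "\<forall>\<^sub>F x in at t within S. isCont g x"
    using assms(3) by (simp add: continuous_towards_def)
  with eventually_nhds_within_open[OF assms(1,2)]
  have "\<forall>\<^sub>F x in at t within S. isCont f x"
    by eventually_elim (simp add: isCont_cong)
  moreover obtain l where "(g \<longlongrightarrow> l) (at t within S)"
    using assms(3) by (auto simp: continuous_towards_def)
  then have "(f \<longlongrightarrow> l) (at t within S)"
    using tendsto_cong[OF assms(2)] by blast
  ultimately show ?thesis
    by (auto simp: continuous_towards_def)
qed

lemma continuous_towards_continuous:
  assumes "continuous_on UNIV f"
  shows "continuous_towards (at t within S) f"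
  using assms
  by (auto simp: continuous_towards_def continuous_on_eq_continuous_at continuous_within
      intro!: exI[of _ "f t"] intro: tendsto_within_subset)

lemma continuous_towards_compose2:
  assumes "bounded_bilinear s" "continuous_towards F f" "continuous_towards F g"
  shows "continuous_towards F (\<lambda>t. s (f t) (g t))"
proof -
  obtain l m where "(f \<longlongrightarrow> l) F" "(g \<longlongrightarrow> m) F"
    using assms(2,3) by (auto simp: continuous_towards_def)
  then have "((\<lambda>t. s (f t) (g t)) \<longlongrightarrow> s l m) F"
    by (rule bounded_bilinear.tendsto[OF assms(1)])
  moreover have "\<forall>\<^sub>F x in F. isCont f x" "\<forall>\<^sub>F x in F. isCont g x"
    using assms(2,3) by (simp_all add: continuous_towards_def)
  then have "\<forall>\<^sub>F x in F. isCont (\<lambda>t. s (f t) (g t)) x"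
    by eventually_elim (rule bounded_bilinear.isCont[OF assms(1)])
  ultimately show ?thesis
    by (auto simp: continuous_towards_def)
qed

lemma continuous_towards_bounded_linear:
  assumes "bounded_linear h" "continuous_towards F f"
  shows "continuous_towards F (\<lambda>t. h (f t))"
proof -
  obtain l where "(f \<longlongrightarrow> l) F"
    using assms(2) by (auto simp: continuous_towards_def)
  then have "((\<lambda>t. h (f t)) \<longlongrightarrow> h l) F"
    by (rule bounded_linear.tendsto[OF assms(1)])
  moreover have "\<forall>\<^sub>F x in F. isCont f x"
    using assms(2) by (simp add: continuous_towards_def)
  then have "\<forall>\<^sub>F x in F. isCont (\<lambda>t. h (f t)) x"
    by eventually_elim (rule bounded_linear.isCont[OF assms(1)])
  ultimately show ?thesis
    by (auto simp: continuous_towards_def)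
qed

text \<open>For the converse, one-sided continuity around every point means that the discontinuities
  in [a, b] accumulate nowhere, so by compactness there are only finitely many.\<close>

lemma locally_piecewise_continuous_iff:
  fixes f :: "real \<Rightarrow> 'a::t2_space"
  shows "locally_piecewise_continuous f \<longleftrightarrow>
    (\<forall>t. continuous_towards (at_left t) f \<and> continuous_towards (at_right t) f)"
proof (intro iffI allI)
  fix t assume f: "locally_piecewise_continuous f"
  then have "piecewise_continuous_on_Icc (t - 1) (t + 1) f"
    by (simp add: locally_piecewise_continuous_def)
  then obtain S where S: "finite S" "continuous_on ({t - 1..t + 1} - S) f"
    and l: "\<forall>x\<in>{t - 1<..t + 1}. \<exists>l. (f \<longlongrightarrow> l) (at_left x)"
    and r: "\<forall>x\<in>{t - 1..<t + 1}. \<exists>l. (f \<longlongrightarrow> l) (at_right x)"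
    unfolding piecewise_continuous_on_Icc_def by blast
  have "isCont f x" if "x \<in> {t - 1<..<t + 1} - S" for x
  proof -
    have "open ({t - 1<..<t + 1} - S)"
      using S(1) by (intro open_Diff finite_imp_closed) auto
    moreover have "continuous_on ({t - 1<..<t + 1} - S) f"
      using S(2) by (rule continuous_on_subset) auto
    ultimately show ?thesis
      using that by (simp add: continuous_on_eq_continuous_at)
  qed
  \<comment> \<open>The point \<open>t\<close> may itself lie in \<open>S\<close>. The punctured
    filter ignores it, so only \<open>S - {t}\<close> is removed to keep a neighbourhood of
    \<open>t\<close>.\<close>
  moreover have "\<forall>\<^sub>F x in at t. x \<in> {t - 1<..<t + 1} - S"
    unfolding eventually_at_topological using S(1)
    by (intro exI[of _ "{t - 1<..<t + 1} - (S - {t})"]) (auto intro!: open_Diff finite_imp_closed)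
  ultimately have "\<forall>\<^sub>F x in at t. isCont f x"
    by (auto elim: eventually_mono)
  with l r show "continuous_towards (at_left t) f \<and> continuous_towards (at_right t) f"
    unfolding continuous_towards_def eventually_at_split by auto
next
  assume f: "\<forall>t. continuous_towards (at_left t) f \<and> continuous_towards (at_right t) f"
  show "locally_piecewise_continuous f"
    unfolding locally_piecewise_continuous_def piecewise_continuous_on_Icc_def
  proof (intro allI impI)
    fix a b :: real
    define S where "S = {x \<in> {a..b}. \<not> isCont f x}"
    have "\<not> t islimpt S" for t
    proof -
      have "\<forall>\<^sub>F x in at t. isCont f x"
        using f by (simp add: continuous_towards_def eventually_at_split)
      then show ?thesis
        by (auto simp: islimpt_iff_eventually S_def elim: eventually_mono)
    qed
    then have "finite S"
      using compact_eq_Bolzano_Weierstrass[of "{a..b}"] by (force simp: S_def)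
    moreover have "continuous_on ({a..b} - S) f"
      by (auto simp: S_def intro!: continuous_at_imp_continuous_on)
    ultimately show "\<exists>S. finite S \<and> continuous_on ({a..b} - S) f \<and>
        (\<forall>t\<in>{a<..b}. \<exists>l. (f \<longlongrightarrow> l) (at_left t)) \<and> (\<forall>t\<in>{a..<b}. \<exists>l. (f \<longlongrightarrow> l) (at_right t))"
      using f by (auto simp: continuous_towards_def)
  qed
qed

lemma locally_piecewise_continuous_continuous:
  fixes f :: "real \<Rightarrow> 'a::t2_space"
  assumes "continuous_on UNIV f"
  shows "locally_piecewise_continuous f"
  unfolding locally_piecewise_continuous_iff
  using assms by (simp add: continuous_towards_continuous)

lemma locally_piecewise_continuous_bilinear:
  fixes f :: "real \<Rightarrow> 'a::real_normed_vector" and g :: "real \<Rightarrow> 'b::real_normed_vector"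
  assumes "bounded_bilinear s" "locally_piecewise_continuous f" "locally_piecewise_continuous g"
  shows "locally_piecewise_continuous (\<lambda>t. s (f t) (g t))"
  using assms unfolding locally_piecewise_continuous_iff
  by (simp add: continuous_towards_compose2)

lemma locally_piecewise_continuous_linear:
  fixes f :: "real \<Rightarrow> 'a::real_normed_vector"
  assumes "bounded_linear h" "locally_piecewise_continuous f"
  shows "locally_piecewise_continuous (\<lambda>t. h (f t))"
  using assms unfolding locally_piecewise_continuous_iff
  by (simp add: continuous_towards_bounded_linear)

text \<open>The index \<open>\<lfloor>t / r\<rfloor>\<close> is constant just to the left and just
  to the right of each point. The two constants differ exactly at multiples of \<open>r\<close>,
  which is why the left one is written with the ceiling.\<close>

lemma locally_piecewise_continuous_glue:
  fixes \<psi> :: "int \<Rightarrow> real \<Rightarrow> 'a::t2_space"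
  assumes "\<And>n. locally_piecewise_continuous (\<psi> n)" "0 < r"
  shows "locally_piecewise_continuous (\<lambda>t. \<psi> \<lfloor>t / r\<rfloor> t)"
  unfolding locally_piecewise_continuous_iff
proof (intro allI conjI)
  fix t
  have "\<lfloor>x / r\<rfloor> = \<lceil>t / r\<rceil> - 1" if "r * (\<lceil>t / r\<rceil> - 1) < x" "x < t" for x
  proof -
    have "x / r < t / r" using that \<open>0 < r\<close> by (simp add: divide_strict_right_mono)
    moreover have "of_int \<lceil>t / r\<rceil> - 1 < x / r"
      using that \<open>0 < r\<close> by (simp add: field_simps)
    ultimately show ?thesis by linarith
  qed
  moreover have "r * (\<lceil>t / r\<rceil> - 1) < t"
    using \<open>0 < r\<close> ceiling_correct[of "t / r"] by (simp add: field_simps)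
  ultimately have "\<forall>\<^sub>F x in at_left t. \<psi> \<lfloor>x / r\<rfloor> x = \<psi> (\<lceil>t / r\<rceil> - 1) x"
    by (auto simp: eventually_at_left)
  then show "continuous_towards (at_left t) (\<lambda>t. \<psi> \<lfloor>t / r\<rfloor> t)"
    by (rule continuous_towards_cong[OF open_lessThan])
      (use assms(1) in \<open>simp add: locally_piecewise_continuous_iff\<close>)
  have "\<lfloor>x / r\<rfloor> = \<lfloor>t / r\<rfloor>" if "t < x" "x < r * (\<lfloor>t / r\<rfloor> + 1)" for x
  proof -
    have "t / r < x / r" using that \<open>0 < r\<close> by (simp add: divide_strict_right_mono)
    moreover have "x / r < of_int \<lfloor>t / r\<rfloor> + 1"
      using that \<open>0 < r\<close> by (simp add: field_simps)
    ultimately show ?thesis by linarith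
  qed
  moreover have "t < r * (\<lfloor>t / r\<rfloor> + 1)"
    using \<open>0 < r\<close> floor_correct[of "t / r"] by (simp add: field_simps)
  ultimately have "\<forall>\<^sub>F x in at_right t. \<psi> \<lfloor>x / r\<rfloor> x = \<psi> \<lfloor>t / r\<rfloor> x"
    by (auto simp: eventually_at_right)
  then show "continuous_towards (at_right t) (\<lambda>t. \<psi> \<lfloor>t / r\<rfloor> t)"
    by (rule continuous_towards_cong[OF open_greaterThan])
      (use assms(1) in \<open>simp add: locally_piecewise_continuous_iff\<close>)
qed

section \<open>Boundedness and integrability on compact intervals\<close>

text \<open>Bolzano's bisection principle: the property passes to adjacent intervals joined
  together, and it holds on short intervals around each point because of the one-sided limits.
  Integrability below is proved in the same way.\<close>

lemma locally_piecewise_continuous_bounded: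
  fixes f :: "real \<Rightarrow> 'a::real_normed_vector"
  assumes "locally_piecewise_continuous f"
  shows "bounded (f ` {a..b})"
proof (cases "a \<le> b")
  case True
  then show ?thesis
  proof (induction rule: Bolzano)
    case (trans a b c)
    then have "{a..c} = {a..b} \<union> {b..c}"
      by auto
    with trans show ?case
      by (simp add: image_Un)
  next
    case (local t)
    obtain l r where lr: "(f \<longlongrightarrow> l) (at_left t)" "(f \<longlongrightarrow> r) (at_right t)"
      using assms unfolding locally_piecewise_continuous_iff continuous_towards_def by meson
    \<comment> \<open>The value at \<open>t\<close> is unrelated to the one-sided limits and must be
      included; the added 1 makes the bounds on the limits strict.\<close>
    define B where "B = max (norm (f t)) (max (norm l) (norm r) + 1)"
    have B: "norm (f t) \<le> B" "norm l < B" "norm r < B"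
      by (auto simp: B_def max_def)
    have "\<forall>\<^sub>F x in at_left t. norm (f x) < B" "\<forall>\<^sub>F x in at_right t. norm (f x) < B"
      using order_tendstoD(2)[OF tendsto_norm[OF lr(1)] B(2)] order_tendstoD(2)[OF tendsto_norm[OF lr(2)] B(3)]
      by simp_all
    then have "\<forall>\<^sub>F x in at t. norm (f x) \<le> B"
      by (auto simp: eventually_at_split elim: eventually_mono)
    then obtain d where d: "d > 0" "\<And>x. x \<noteq> t \<Longrightarrow> dist x t < d \<Longrightarrow> norm (f x) \<le> B"
      by (auto simp: eventually_at)
    have "bounded (f ` {u..v})" if "u \<le> t \<and> t \<le> v \<and> v - u < d" for u v
    proof -
      have "norm (f x) \<le> B" if "x \<in> {u..v}" for x
        using d(2)[of x] B(1) that \<open>u \<le> t \<and> t \<le> v \<and> v - u < d\<close>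
        by (cases "x = t") (auto simp: dist_real_def)
      then show ?thesis
        by (intro boundedI[of _ B]) auto
    qed
    with d(1) show ?case by blast
  qed
qed simp

text \<open>Replacing the two end values by the one-sided limits gives a continuous function on the
  closed interval that differs from \<open>f\<close> in at most two points.\<close>

lemma integrable_continuous_real_Ioo:
  fixes f :: "real \<Rightarrow> 'a::banach"
  assumes "continuous_on {a<..<b} f" "(f \<longlongrightarrow> l) (at_right a)" "(f \<longlongrightarrow> m) (at_left b)"
  shows "f integrable_on {a..b}"
proof (cases "a < b")
  case True
  define g where "g = (\<lambda>x. if x = a then l else if x = b then m else f x)"
  have *: "\<forall>\<^sub>F x in F. g x = f x" if "\<forall>\<^sub>F x in F. x \<in> {a<..<b}" for F
    using that by eventually_elim (auto simp: g_def)
  have "continuous_on {a..b} g"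
  proof (rule continuous_on_IccI)
    show "(g \<longlongrightarrow> g a) (at_right a)"
      using assms(2) tendsto_cong[OF *[of "at_right a"]] eventually_at_rightI[of a b "\<lambda>x. x \<in> {a<..<b}"] True
      by (simp add: g_def)
    show "(g \<longlongrightarrow> g b) (at_left b)"
      using assms(3) tendsto_cong[OF *[of "at_left b"]] eventually_at_leftI[of a b "\<lambda>x. x \<in> {a<..<b}"] True
      by (simp add: g_def)
    show "g \<midarrow>x\<rightarrow> g x" if "a < x" "x < b" for x
      using assms(1) tendsto_cong[OF *[of "at x"]] eventually_at_in_open'[of "{a<..<b}" x] that
      by (simp add: g_def continuous_on_eq_continuous_at isCont_def)
  qed (use True in auto)
  then have "g integrable_on {a..b}"
    by (rule integrable_continuous_interval)
  then show ?thesis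
    by (rule integrable_spike_finite[of "{a, b}", rotated 2]) (auto simp: g_def)
next
  case False
  then show ?thesis
    by (cases "a = b") (use integrable_on_refl[of f a] in auto)
qed

lemma locally_piecewise_continuous_integrable:
  fixes f :: "real \<Rightarrow> 'a::banach"
  assumes "locally_piecewise_continuous f"
  shows "f integrable_on {a..b}"
proof (cases "a \<le> b")
  case True
  then show ?thesis
  proof (induction rule: Bolzano)
    case (trans a b c)
    then show ?case
      by (intro Henstock_Kurzweil_Integration.integrable_combine[of a b c])
  next
    case (local t)
    have lr: "\<exists>l. (f \<longlongrightarrow> l) (at_left x)" "\<exists>l. (f \<longlongrightarrow> l) (at_right x)" for x
      using assms by (auto simp: locally_piecewise_continuous_iff continuous_towards_def)
    have "\<forall>\<^sub>F x in at t. isCont f x"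
      using assms by (auto simp: locally_piecewise_continuous_iff continuous_towards_def eventually_at_split)
    then obtain d where d: "d > 0" "\<And>x. x \<noteq> t \<Longrightarrow> dist x t < d \<Longrightarrow> isCont f x"
      by (auto simp: eventually_at)
    \<comment> \<open>With \<open>t\<close> as an endpoint, the only possible discontinuity is not
      in the open interval. A general short interval is then cut at \<open>t\<close>.\<close>
    have *: "f integrable_on {u..v}" if "v - u < d" "t = u \<or> t = v" for u v
    proof -
      have "isCont f x" if "x \<in> {u<..<v}" for x
        using d(2)[of x] that \<open>v - u < d\<close> \<open>t = u \<or> t = v\<close> by (auto simp: dist_real_def)
      then have "continuous_on {u<..<v} f"
        by (simp add: continuous_at_imp_continuous_on)
      then show ?thesis
        using lr(1)[of v] lr(2)[of u] integrable_continuous_real_Ioo by blast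
    qed
    have "f integrable_on {u..v}" if "u \<le> t \<and> t \<le> v \<and> v - u < d" for u v
      using that by (intro Henstock_Kurzweil_Integration.integrable_combine[of u t v] *) auto
    with d(1) show ?case by blast
  qed
qed auto

text \<open>Riemann sums are linear combinations of values of \<open>f\<close>, and the integral is
  a limit of them. This keeps integrals of pairs inside the intersection of the couple.\<close>

lemma integral_in_closed_subspace:
  fixes f :: "real \<Rightarrow> 'a::banach"
  assumes "subspace S" "closed S" "f integrable_on {a..b}" "\<And>t. f t \<in> S"
  shows "integral {a..b} f \<in> S"
proof -
  have "\<exists>y\<in>S. dist y (integral {a..b} f) < e" if "e > 0" for e
  proof -
    have "\<exists>\<gamma>. gauge \<gamma> \<and> (\<forall>p. p tagged_division_of {a..b} \<and> \<gamma> fine p \<longrightarrow>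
        norm ((\<Sum>(x, k)\<in>p. measure lborel k *\<^sub>R f x) - integral {a..b} f) < e)"
      using integrable_integral[OF assms(3)] \<open>e > 0\<close> by (simp only: has_integral_real)
    then obtain \<gamma> where \<gamma>: "gauge \<gamma>" "\<And>p. p tagged_division_of {a..b} \<Longrightarrow> \<gamma> fine p \<Longrightarrow>
        norm ((\<Sum>(x, k)\<in>p. measure lborel k *\<^sub>R f x) - integral {a..b} f) < e"
      by auto
    obtain p where "p tagged_division_of {a..b}" "\<gamma> fine p"
      using fine_division_exists_real[OF \<gamma>(1)] by blast
    moreover have "(\<Sum>(x, k)\<in>p. measure lborel k *\<^sub>R f x) \<in> S"
      using assms(1,4) by (auto intro!: subspace_sum simp: subspace_scale)
    ultimately show ?thesis
      using \<gamma>(2) unfolding dist_norm by blast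
  qed
  then have "integral {a..b} f \<in> closure S"
    by (simp add: closure_approachable)
  then show ?thesis
    by (simp only: closure_closed[OF assms(2)])
qed

section \<open>The gliding hump argument\<close>

text \<open>The gliding hump in abstract form. \<open>K n\<close> stands for all possible
  contributions of the n-th annulus; as the choices at different \<open>n\<close> are independent,
  humps taken from different selections can be combined into one selection, which then fails the
  Cauchy criterion.\<close>

lemma selections_bounded:
  fixes K :: "nat \<Rightarrow> 'a::banach set"
  assumes K: "\<And>n. bounded (K n)"
    and summable: "\<And>z. (\<forall>n. z n \<in> K n) \<Longrightarrow> summable z"
  shows "\<exists>B. \<forall>z N. (\<forall>n. z n \<in> K n) \<longrightarrow> norm (\<Sum>n<N. z n) \<le> B"
proof (rule ccontr)
  assume "\<not> ?thesis"
  then have unbounded: "\<exists>z N. (\<forall>n. z n \<in> K n) \<and> B < norm (\<Sum>n<N. z n)" for B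
    by (auto simp: not_le)
  have "\<exists>b. \<forall>y\<in>K n. norm y \<le> b" for n
    using K[of n] by (auto simp: bounded_iff)
  then obtain b where b: "\<And>n y. y \<in> K n \<Longrightarrow> norm y \<le> b n"
    by metis
  \<comment> \<open>The first \<open>M\<close> terms of any selection contribute at most the sum of
    the \<open>\<bar>b n\<bar>\<close>, so a partial sum exceeding this by 1 must have a hump beyond
    \<open>M\<close>.\<close>
  have "\<exists>z N. M < N \<and> (\<forall>n. z n \<in> K n) \<and> 1 \<le> norm (\<Sum>n=M..<N. z n)" for M
  proof -
    obtain z N where z: "\<forall>n. z n \<in> K n" and N: "1 + (\<Sum>n<M. \<bar>b n\<bar>) < norm (\<Sum>n<N. z n)"
      using unbounded by blast
    have small: "norm (\<Sum>n<k. z n) \<le> (\<Sum>n<M. \<bar>b n\<bar>)" if "k \<le> M" for k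
    proof -
      have "norm (\<Sum>n<k. z n) \<le> (\<Sum>n<k. \<bar>b n\<bar>)"
        using b z by (intro sum_norm_le) (meson abs_ge_self order_trans)
      also have "\<dots> \<le> (\<Sum>n<M. \<bar>b n\<bar>)"
        using that by (intro sum_mono2) auto
      finally show ?thesis .
    qed
    have "M < N"
      using small[of N] N by force
    then have "(\<Sum>n<N. z n) = (\<Sum>n<M. z n) + (\<Sum>n=M..<N. z n)"
      by (simp add: sum.atLeastLessThan_concat flip: atLeast0LessThan)
    then have "1 \<le> norm (\<Sum>n=M..<N. z n)"
      using N small[of M] norm_triangle_ineq[of "\<Sum>n<M. z n" "\<Sum>n=M..<N. z n"] by simp
    then show ?thesis
      using z \<open>M < N\<close> by blast
  qed
  then obtain Z N where Z: "\<And>M. M < N M" "\<And>M n. Z M n \<in> K n"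
      "\<And>M. 1 \<le> norm (\<Sum>n=M..<N M. Z M n)"
    by metis
  define \<rho> where "\<rho> k = (N ^^ k) 0" for k
  have \<rho>_Suc: "\<rho> (Suc k) = N (\<rho> k)" for k
    by (simp add: \<rho>_def)
  have \<rho>: "strict_mono \<rho>"
    using Z(1) by (simp add: strict_mono_Suc_iff \<rho>_Suc)
  \<comment> \<open>The \<open>LEAST\<close> locates the stretch from \<open>\<rho> k\<close> to
    \<open>\<rho> (Suc k)\<close> containing \<open>n\<close>; there \<open>w\<close> copies the
    selection with a hump on that stretch.\<close>
  define w where "w n = Z (\<rho> (LEAST k. n < \<rho> (Suc k))) n" for n
  have w: "w n = Z (\<rho> k) n" if "\<rho> k \<le> n" "n < \<rho> (Suc k)" for n k
  proof -
    have "k \<le> j" if "n < \<rho> (Suc j)" for j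
      using strict_mono_less[OF \<rho>, of k "Suc j"] \<open>\<rho> k \<le> n\<close> that by simp
    then have "(LEAST k. n < \<rho> (Suc k)) = k"
      using that by (intro Least_equality) auto
    then show ?thesis
      by (simp add: w_def)
  qed
  have "summable w"
    using Z(2) by (intro summable) (simp add: w_def)
  then obtain M where M: "\<And>m n. M \<le> m \<Longrightarrow> norm (\<Sum>n=m..<n. w n) < 1"
    unfolding summable_Cauchy by (metis zero_less_one)
  have "norm (\<Sum>n=\<rho> M..<\<rho> (Suc M). w n) < 1"
    using M strict_mono_imp_increasing[OF \<rho>] by blast
  also have "(\<Sum>n=\<rho> M..<\<rho> (Suc M). w n) = (\<Sum>n=\<rho> M..<N (\<rho> M). Z (\<rho> M) n)"
    using w by (intro sum.cong) (auto simp: \<rho>_Suc)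
  finally show False
    using Z(3)[of "\<rho> M"] by simp
qed

section \<open>Integrals over blocks\<close>

definition block_integral :: "real \<Rightarrow> (real \<Rightarrow> 'a::banach) \<Rightarrow> int \<Rightarrow> 'a" where
  "block_integral r g n = integral {of_int n * r..(of_int n + 1) * r} g"

text \<open>Block \<open>- n - 1\<close> is the mirror image of block \<open>n\<close> about 0, so
  each pair fills one annulus. The index range is half-open because blocks -N to N - 1 tile
  [-N r, N r].\<close>

lemma sum_symmetric_int:
  fixes y :: "int \<Rightarrow> 'a::comm_monoid_add"
  shows "(\<Sum>n=- int N..<int N. y n) = (\<Sum>n<N. y (int n) + y (- int n - 1))"
proof (induction N)
  case (Suc N)
  have "{- int (Suc N)..<int (Suc N)} = insert (int N) (insert (- int N - 1) {- int N..<int N})"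
    by auto
  then show ?case
    using Suc by (simp add: ac_simps)
qed simp

text \<open>Separates the block [N r, (N + 1) r], which the symmetric range of indices has in excess
  of the symmetric interval.\<close>

lemma sym_partial_sum_eq:
  "sym_partial_sum x N = (\<Sum>n=- int N..<int N. x n) + x (int N)"
proof -
  have "{- int N..int N} = insert (int N) {- int N..<int N}"
    by auto
  then show ?thesis
    by (simp add: sym_partial_sum_def add.commute)
qed

lemma sym_partial_sum_Suc:
  "sym_partial_sum x (Suc N) = sym_partial_sum x N + x (int (Suc N)) + x (- int N - 1)"
  unfolding sym_partial_sum_eq sum_symmetric_int by (simp add: ac_simps)

lemma sym_integral_blocks:
  assumes g: "\<And>a b. g integrable_on {a..b}" and "0 \<le> r"
  shows "sym_integral g (real N * r) = (\<Sum>n=- int N..<int N. block_integral r g n)"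
proof (induction N)
  case (Suc N)
  let ?a = "- (real (Suc N) * r)" and ?b = "- (real N * r)" and ?c = "real N * r" and ?d = "real (Suc N) * r"
  have le: "?a \<le> ?b" "?b \<le> ?c" "?c \<le> ?d"
    using \<open>0 \<le> r\<close> by (auto simp: algebra_simps)
  have "integral {?a..?d} g = integral {?a..?b} g + integral {?b..?c} g + integral {?c..?d} g"
    using le by (simp add: Henstock_Kurzweil_Integration.integral_combine g)
  moreover have "integral {?c..?d} g = block_integral r g (int N)"
    by (simp add: block_integral_def add.commute)
  moreover have "integral {?a..?b} g = block_integral r g (- int N - 1)"
    by (simp add: block_integral_def algebra_simps minus_diff_commute)
  moreover have "(\<Sum>n=- int (Suc N)..<int (Suc N). block_integral r g n)
      = (\<Sum>n=- int N..<int N. block_integral r g n) + block_integral r g (int N) + block_integral r g (- int N - 1)"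
    unfolding sum_symmetric_int by (simp add: ac_simps)
  ultimately show ?case
    using Suc by (simp add: sym_integral_def ac_simps)
qed (simp add: sym_integral_def)

text \<open>The interval [-R, R] arises from [-N r, (N + 1) r] by cutting off the end of block
  \<open>N\<close> and attaching a piece of block \<open>- N - 1\<close>. These two pieces are the
  only error terms between integrals and partial sums.\<close>

lemma sym_integral_decompose:
  assumes g: "\<And>a b. g integrable_on {a..b}" and "0 \<le> r" "real N * r \<le> R" "R \<le> (real N + 1) * r"
  shows "sym_integral g R = sym_partial_sum (block_integral r g) N
    - integral {R..(real N + 1) * r} g + integral {- R..- (real N * r)} g"
proof -
  have nonneg: "- R \<le> real N * r" "- (real N * r) \<le> real N * r"
    using mult_nonneg_nonneg[OF of_nat_0_le_iff[of N] assms(2)] assms(3) by linarith+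
  have "block_integral r g (int N) = integral {real N * r..R} g + integral {R..(real N + 1) * r} g"
    using assms by (simp add: block_integral_def Henstock_Kurzweil_Integration.integral_combine)
  moreover have "sym_integral g R = integral {- R..- (real N * r)} g + sym_integral g (real N * r) + integral {real N * r..R} g"
    using Henstock_Kurzweil_Integration.integral_combine[OF _ nonneg(2) g, of "- R"]
      Henstock_Kurzweil_Integration.integral_combine[OF nonneg(1) assms(3) g] assms(3)
    by (simp add: sym_integral_def)
  ultimately show ?thesis
    using assms(1,2) by (simp add: sym_partial_sum_eq flip: sym_integral_blocks)
qed

lemma integral_within_block:
  assumes "0 < r" "of_int n * r \<le> a" "b \<le> (of_int n + 1) * r"
    and "\<And>t. \<lfloor>t / r\<rfloor> = n \<Longrightarrow> g t = h t"
  shows "integral {a..b} g = integral {a..b} h"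
\<comment> \<open>The right endpoint already has the floor of the next block, so the integrands may
  differ there.\<close>
proof (rule integral_spike[of "{(of_int n + 1) * r}"])
  fix t assume t: "t \<in> {a..b} - {(of_int n + 1) * r}"
  then have "of_int n * r \<le> t" "t < (of_int n + 1) * r"
    using assms(2,3) by auto
  then have "\<lfloor>t / r\<rfloor> = n"
    using assms(1) by (simp add: floor_eq_iff field_simps)
  then show "h t = g t"
    using assms(4) by simp
qed simp

lemma filterlim_nat_floor_divide:
  assumes "0 < r"
  shows "filterlim (\<lambda>R::real. nat \<lfloor>R / r\<rfloor>) sequentially at_top"
proof -
  have "filterlim (\<lambda>R. inverse r * R) at_top at_top"
    using assms by (intro filterlim_tendsto_pos_mult_at_top[OF tendsto_const]) (auto intro: filterlim_ident)
  then have "filterlim (\<lambda>R. R / r) at_top at_top"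
    by (simp add: divide_inverse mult.commute)
  then show ?thesis
    by (intro filterlim_compose[OF filterlim_nat_sequentially] filterlim_compose[OF filterlim_floor_sequentially])
qed

lemma nat_floor_divide_bounds:
  assumes "0 < r" "0 \<le> R"
  shows "real (nat \<lfloor>R / r\<rfloor>) * r \<le> R" "R \<le> (real (nat \<lfloor>R / r\<rfloor>) + 1) * r"
proof -
  have *: "real (nat \<lfloor>R / r\<rfloor>) = of_int \<lfloor>R / r\<rfloor>"
    using assms by simp
  show "real (nat \<lfloor>R / r\<rfloor>) * r \<le> R" "R \<le> (real (nat \<lfloor>R / r\<rfloor>) + 1) * r"
    unfolding * using floor_divide_lower[OF assms(1), of R] floor_divide_upper[OF assms(1), of R] by simp_all
qed

text \<open>The bound is required on all subintervals of a block: the integral over a full block may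
  be small by cancellation and says nothing about the incomplete blocks at \<plusminus>R.\<close>

lemma sym_integral_tendsto_blocks:
  assumes g: "\<And>a b. g integrable_on {a..b}" and "0 < r"
    and bound: "\<And>n a b. of_int n * r \<le> a \<Longrightarrow> a \<le> b \<Longrightarrow> b \<le> (of_int n + 1) * r \<Longrightarrow>
      norm (integral {a..b} g) \<le> M n"
    and M: "(\<lambda>N. M (int N)) \<longlonglongrightarrow> 0" "(\<lambda>N. M (- int N - 1)) \<longlonglongrightarrow> 0"
    and L: "sym_partial_sum (block_integral r g) \<longlonglongrightarrow> L"
  shows "(sym_integral g \<longlongrightarrow> L) at_top"
proof -
  define N where "N R = nat \<lfloor>R / r\<rfloor>" for R
  have N: "filterlim N sequentially at_top"
    unfolding N_def by (rule filterlim_nat_floor_divide[OF \<open>0 < r\<close>])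
  have "((\<lambda>R. sym_integral g R - sym_partial_sum (block_integral r g) (N R)) \<longlongrightarrow> 0) at_top"
  proof (rule Lim_null_comparison)
    show "((\<lambda>R. M (int (N R)) + M (- int (N R) - 1)) \<longlongrightarrow> 0) at_top"
      using tendsto_add[OF filterlim_compose[OF M(1) N] filterlim_compose[OF M(2) N]] by simp
    have "norm (sym_integral g R - sym_partial_sum (block_integral r g) (N R))
        \<le> M (int (N R)) + M (- int (N R) - 1)" if "0 \<le> R" for R
    proof -
      have NR: "real (N R) * r \<le> R" "R \<le> (real (N R) + 1) * r"
        unfolding N_def using nat_floor_divide_bounds[OF \<open>0 < r\<close> that] by auto
      have "norm (integral {R..(real (N R) + 1) * r} g) \<le> M (int (N R))"
        using NR by (intro bound) auto
      moreover have "norm (integral {- R..- (real (N R) * r)} g) \<le> M (- int (N R) - 1)"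
        using NR by (intro bound) (auto simp: algebra_simps)
      ultimately show ?thesis
        using norm_triangle_ineq4[of "integral {- R..- (real (N R) * r)} g" "integral {R..(real (N R) + 1) * r} g"] NR \<open>0 < r\<close>
        by (simp add: sym_integral_decompose[OF g, of r "N R"])
    qed
    then show "\<forall>\<^sub>F R in at_top. norm (sym_integral g R - sym_partial_sum (block_integral r g) (N R))
        \<le> M (int (N R)) + M (- int (N R) - 1)"
      by (rule eventually_at_top_linorderI)
  qed
  from tendsto_add[OF this filterlim_compose[OF L N]] show ?thesis
    by simp
qed

section \<open>Sequences and functions in a single space\<close>

context banach_space_over
begin

lemma bounded_bilinear_scale: "bounded_bilinear scale"
proof
  show "scale (k *\<^sub>R a) x = k *\<^sub>R scale a x" for k a x
    by (simp add: scaleR_conv_of_real scale_of_real flip: scale_scale)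
  show "scale a (k *\<^sub>R x) = k *\<^sub>R scale a x" for k a x
    by (metis scale_left_commute scale_of_real)
  show "\<exists>K. \<forall>a x. norm (scale a x) \<le> norm a * norm x * K"
    by (intro exI[of _ 1]) (simp add: norm_scale)
qed (simp_all add: scale_left_distrib scale_right_distrib)

text \<open>The exponent \<open>c\<close> stands for 0 - \<theta> or 1 - \<theta>. Leaving it
  arbitrary lets one set of lemmas serve both spaces of the couple.\<close>

abbreviation weighted :: "real \<Rightarrow> (real \<Rightarrow> 'f) \<Rightarrow> (real \<Rightarrow> 'a) \<Rightarrow> real \<Rightarrow> 'a" where
  "weighted c \<phi> f \<equiv> \<lambda>t. exp (c * t) *\<^sub>R scale (\<phi> t) (f t)"

lemma weighted_integrable:
  assumes "locally_piecewise_continuous \<phi>" "locally_piecewise_continuous f"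
  shows "weighted c \<phi> f integrable_on {a..b}"
  by (intro locally_piecewise_continuous_integrable assms
      locally_piecewise_continuous_bilinear[OF bounded_bilinear_scaleR]
      locally_piecewise_continuous_bilinear[OF bounded_bilinear_scale]
      locally_piecewise_continuous_continuous continuous_intros)

text \<open>Consecutive symmetric partial sums differ by one term at each end, and convergence alone
  controls only their sum. The multipliers that are 1 on one half of the indices and 0 on the other
  separate the two terms.\<close>

lemma unconditionally_convergent_tail:
  assumes "unconditionally_convergent scale x"
  shows "(\<lambda>N. x (int N)) \<longlonglongrightarrow> 0" "(\<lambda>N. x (- int N - 1)) \<longlonglongrightarrow> 0"
proof -
  have "(\<lambda>N. sym_partial_sum (\<lambda>n. scale (l n) (x n)) (Suc N)
      - sym_partial_sum (\<lambda>n. scale (l n) (x n)) N) \<longlonglongrightarrow> 0" if "range l \<subseteq> {0, 1}" for l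
  proof -
    have "bounded (range l)"
      using that by (rule bounded_subset[rotated]) auto
    then obtain L where "sym_partial_sum (\<lambda>n. scale (l n) (x n)) \<longlonglongrightarrow> L"
      using assms by (auto simp: unconditionally_convergent_def convergent_def)
    from tendsto_diff[OF LIMSEQ_Suc[OF this] this] show ?thesis
      by simp
  qed
  from this[of "\<lambda>n. if 0 \<le> n then 1 else 0"] this[of "\<lambda>n. if 0 \<le> n then 0 else 1"]
  have "(\<lambda>N. x (int (Suc N))) \<longlonglongrightarrow> 0" "(\<lambda>N. x (- int N - 1)) \<longlonglongrightarrow> 0"
    by (auto simp: sym_partial_sum_Suc image_subset_iff)
  then show "(\<lambda>N. x (int N)) \<longlonglongrightarrow> 0" "(\<lambda>N. x (- int N - 1)) \<longlonglongrightarrow> 0"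
    by (auto intro: LIMSEQ_imp_Suc)
qed

lemma unit_funs_glue:
  assumes "\<And>n. \<psi> n \<in> unit_funs" "0 < r"
  shows "(\<lambda>t. \<psi> \<lfloor>t / r\<rfloor> t) \<in> unit_funs"
  using assms locally_piecewise_continuous_glue[of \<psi> r] by (auto simp: unit_funs_def)

lemma block_integral_weighted_bounded:
  assumes "locally_piecewise_continuous f"
  shows "bounded ((\<lambda>\<phi>. block_integral 1 (weighted c \<phi> f) n) ` unit_funs)"
proof -
  obtain B where B: "\<And>t. t \<in> {of_int n..of_int n + 1} \<Longrightarrow> norm (f t) \<le> B" "0 \<le> B"
    using locally_piecewise_continuous_bounded[OF assms, of "of_int n" "of_int n + 1"]
    by (force simp: bounded_pos)
  define E where "E = exp (\<bar>c\<bar> * (\<bar>of_int n\<bar> + 1))"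
  have "norm (block_integral 1 (weighted c \<phi> f) n) \<le> E * B" if "\<phi> \<in> unit_funs" for \<phi>
  proof -
    have "norm (weighted c \<phi> f t) \<le> E * B" if t: "t \<in> {of_int n..of_int n + 1}" for t
    proof -
      have "c * t \<le> \<bar>c\<bar> * \<bar>t\<bar>"
        by (metis abs_ge_self abs_mult)
      also have "\<dots> \<le> \<bar>c\<bar> * (\<bar>of_int n\<bar> + 1)"
        using t by (intro mult_left_mono) auto
      finally have "exp (c * t) \<le> E"
        by (simp add: E_def)
      moreover have "norm (\<phi> t) * norm (f t) \<le> 1 * B"
        using \<open>\<phi> \<in> unit_funs\<close> B(1)[OF t] by (intro mult_mono) (auto simp: unit_funs_def)
      ultimately show ?thesis
        by (auto simp: norm_scale E_def intro!: mult_mono)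
    qed
    moreover have "(weighted c \<phi> f has_integral block_integral 1 (weighted c \<phi> f) n) {of_int n..of_int n + 1}"
      using weighted_integrable[OF _ assms, of \<phi> c "of_int n" "of_int n + 1"] that
      by (simp add: block_integral_def unit_funs_def integrable_integral)
    ultimately have "norm (block_integral 1 (weighted c \<phi> f) n) \<le> E * B * measure lborel {of_int n..of_int n + 1 :: real}"
      using B(2) by (intro has_integral_bound_real[of _ "{}"]) (auto simp: E_def)
    then show ?thesis
      by simp
  qed
  then show ?thesis
    by (auto simp: bounded_iff)
qed

text \<open>Any choice of one multiplier per annulus can be glued to a single element of
  \<open>unit_funs\<close>, whose integral converges by assumption. So every selection of
  contributions is summable and \<open>selections_bounded\<close> applies. Annuli of width 1
  suffice, as no \<open>r\<close> occurs here.\<close>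

lemma weighted_integrals_bounded:
  assumes f: "locally_piecewise_continuous f"
    and conv: "\<And>\<phi>. \<phi> \<in> unit_funs \<Longrightarrow> \<exists>L. (sym_integral (weighted c \<phi> f) \<longlongrightarrow> L) at_top"
  shows "\<exists>B. \<forall>\<phi>\<in>unit_funs. norm (Lim at_top (sym_integral (weighted c \<phi> f))) \<le> B"
proof -
  define z where "z \<phi> n = block_integral 1 (weighted c \<phi> f) (int n)
    + block_integral 1 (weighted c \<phi> f) (- int n - 1)" for \<phi> n
  have sum_z: "(\<Sum>n<N. z \<phi> n) = sym_integral (weighted c \<phi> f) (real N)" if "\<phi> \<in> unit_funs" for \<phi> N
    using that sym_integral_blocks[of "weighted c \<phi> f" 1 N] weighted_integrable[OF _ f]
    by (simp add: unit_funs_def sum_symmetric_int z_def)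
  have tendsto_z: "(\<lambda>N. \<Sum>n<N. z \<phi> n) \<longlonglongrightarrow> Lim at_top (sym_integral (weighted c \<phi> f))"
    if "\<phi> \<in> unit_funs" for \<phi>
  proof -
    from conv[OF that] obtain L where L: "(sym_integral (weighted c \<phi> f) \<longlongrightarrow> L) at_top"
      by blast
    then have "Lim at_top (sym_integral (weighted c \<phi> f)) = L"
      by (intro tendsto_Lim) auto
    then show ?thesis
      using filterlim_compose[OF L filterlim_real_sequentially] that by (simp add: sum_z)
  qed
  define K where "K n = (\<lambda>\<phi>. z \<phi> n) ` unit_funs" for n
  have "\<exists>B. \<forall>z N. (\<forall>n. z n \<in> K n) \<longrightarrow> norm (\<Sum>n<N. z n) \<le> B"
  proof (rule selections_bounded)
    fix n
    show "bounded (K n)"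
      unfolding K_def z_def
      by (intro bounded_plus_comp block_integral_weighted_bounded f)
  next
    fix w assume "\<forall>n. w n \<in> K n"
    then have "\<forall>n. \<exists>\<phi>. \<phi> \<in> unit_funs \<and> w n = z \<phi> n"
      by (auto simp: K_def)
    then obtain \<Phi> where \<Phi>: "\<And>n. \<Phi> n \<in> unit_funs" "\<And>n. w n = z (\<Phi> n) n"
      by (auto dest!: choice)
    \<comment> \<open>Blocks \<open>n\<close> and \<open>- n - 1\<close> together form annulus
      \<open>n\<close>, so both receive the multiplier \<open>\<Phi> n\<close>.\<close>
    define \<psi> where "\<psi> m = \<Phi> (if 0 \<le> m then nat m else nat (- m - 1))" for m
    define \<phi> where "\<phi> t = \<psi> \<lfloor>t / 1\<rfloor> t" for t
    have \<phi>: "\<phi> \<in> unit_funs"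
      unfolding \<phi>_def by (rule unit_funs_glue[of \<psi> 1]) (auto simp: \<psi>_def \<Phi>(1))
    have "block_integral 1 (weighted c \<phi> f) m = block_integral 1 (weighted c (\<psi> m) f) m" for m
      unfolding block_integral_def
      by (rule integral_within_block[where r = 1 and n = m]) (auto simp: \<phi>_def)
    then have "z (\<Phi> n) n = z \<phi> n" for n
      by (simp add: z_def \<psi>_def)
    then have "w = z \<phi>"
      using \<Phi>(2) by (intro ext) simp
    then show "summable w"
      using tendsto_z[OF \<phi>] by (auto simp: summable_def sums_def)
  qed
  then obtain B where B: "\<And>w N. (\<forall>n. w n \<in> K n) \<Longrightarrow> norm (\<Sum>n<N. w n) \<le> B"
    by blast
  have "norm (Lim at_top (sym_integral (weighted c \<phi> f))) \<le> B" if "\<phi> \<in> unit_funs" for \<phi>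
    using LIMSEQ_le_const2[OF tendsto_norm[OF tendsto_z[OF that]]] B[of "z \<phi>"] that
    by (auto simp: K_def)
  then show ?thesis
    by blast
qed

end

section \<open>Step functions and their block integrals\<close>

definition step_function :: "real \<Rightarrow> (int \<Rightarrow> 'a::real_vector) \<Rightarrow> real \<Rightarrow> 'a" where
  "step_function r x t = (1 / r) *\<^sub>R x \<lfloor>t / r\<rfloor>"

lemma locally_piecewise_continuous_step_function:
  fixes x :: "int \<Rightarrow> 'a::real_normed_vector"
  assumes "0 < r"
  shows "locally_piecewise_continuous (step_function r x)"
  unfolding step_function_def[abs_def]
  by (rule locally_piecewise_continuous_glue[of "\<lambda>n t. (1 / r) *\<^sub>R x n", OF _ assms])
    (intro locally_piecewise_continuous_continuous continuous_intros)

lemma integral_step_function: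
  fixes x :: "int \<Rightarrow> 'a::banach"
  assumes "0 < r" "of_int n * r \<le> a" "a \<le> b" "b \<le> (of_int n + 1) * r"
  shows "integral {a..b} (step_function r x) = ((b - a) / r) *\<^sub>R x n"
proof -
  have "integral {a..b} (step_function r x) = integral {a..b} (\<lambda>t. (1 / r) *\<^sub>R x n)"
    using assms by (intro integral_within_block[where r = r and n = n]) (auto simp: step_function_def)
  then show ?thesis
    using assms(3) by simp
qed

text \<open>Averaging undoes spreading out. Besides computing the blocks of a step function, this
  transfers finiteness of the norm from functions back to sequences.\<close>

lemma block_integral_step_function:
  fixes x :: "int \<Rightarrow> 'a::banach"
  assumes "0 < r"
  shows "block_integral r (step_function r x) = x"
proof
  fix n
  have "of_int n * r \<le> (of_int n + 1) * r"
    using assms by (intro mult_right_mono) auto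
  then show "block_integral r (step_function r x) n = x n"
    using assms integral_step_function[of r n "of_int n * r" "(of_int n + 1) * r" x]
    by (simp add: block_integral_def algebra_simps)
qed

lemma block_integral_bounded_linear:
  assumes "bounded_linear h" "locally_piecewise_continuous f"
  shows "block_integral r (\<lambda>t. h (f t)) n = h (block_integral r f n)"
  unfolding block_integral_def
  using integral_linear[OF locally_piecewise_continuous_integrable[OF assms(2)] assms(1)]
  by (simp add: o_def)

section \<open>Transfer of multipliers between sequences and functions\<close>

context banach_space_over
begin

text \<open>On block \<open>n\<close> the multiplier \<open>l n\<close> is replaced by a function
  that cancels the variation of the weight, so that the weighted integral over the block is exactly
  the n-th weighted term divided by a constant.\<close>

lemma block_integrals_sum:
  assumes f: "locally_piecewise_continuous f"
    and conv: "\<And>\<phi>. \<phi> \<in> unit_funs \<Longrightarrow> \<exists>L. (sym_integral (weighted c \<phi> f) \<longlongrightarrow> L) at_top"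
    and "0 < r" "l \<in> unit_seqs"
  shows "\<exists>\<phi>\<in>unit_funs. sym_partial_sum (\<lambda>n. scale (l n) (exp (c * r * of_int n) *\<^sub>R block_integral r f n))
    \<longlonglongrightarrow> exp (max 0 (- c) * r) *\<^sub>R Lim at_top (sym_integral (weighted c \<phi> f))"
proof -
  \<comment> \<open>The largest value of \<open>exp (- c * d)\<close> for \<open>d\<close> between 0
    and \<open>r\<close>; dividing by it brings the new multiplier into the unit ball.\<close>
  define K where "K = exp (max 0 (- c) * r)"
  have "K > 0"
    by (simp add: K_def)
  define \<psi> where "\<psi> l n t = (exp (c * (r * of_int n - t)) / K) *\<^sub>R l n" for l :: "int \<Rightarrow> 'f" and n t
  define \<phi> where "\<phi> l t = \<psi> l \<lfloor>t / r\<rfloor> t" for l t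
  define y where "y l = block_integral r (weighted c (\<phi> l) f)" for l
  have \<phi>: "\<phi> l \<in> unit_funs" if l: "l \<in> unit_seqs" for l
  proof -
    have "locally_piecewise_continuous (\<psi> l n)" for n
      unfolding \<psi>_def by (intro locally_piecewise_continuous_continuous continuous_intros) (use \<open>K > 0\<close> in auto)
    then have "locally_piecewise_continuous (\<phi> l)"
      unfolding \<phi>_def by (rule locally_piecewise_continuous_glue[OF _ \<open>0 < r\<close>])
    moreover have "norm (\<phi> l t) \<le> 1" for t
    proof -
      define d where "d = t - r * of_int \<lfloor>t / r\<rfloor>"
      have d: "0 \<le> d" "d \<le> r"
        using floor_divide_lower[OF \<open>0 < r\<close>, of t] floor_divide_upper[OF \<open>0 < r\<close>, of t]
        by (simp_all add: d_def algebra_simps)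
      then have "(- c) * d \<le> max 0 (- c) * r"
        by (intro mult_mono) auto
      then have "exp (c * (r * of_int \<lfloor>t / r\<rfloor> - t)) \<le> K"
        by (simp add: K_def d_def algebra_simps)
      then have "exp (c * (r * of_int \<lfloor>t / r\<rfloor> - t)) / K * norm (l \<lfloor>t / r\<rfloor>) \<le> 1 * 1"
        using l \<open>K > 0\<close> by (intro mult_mono) (auto simp: unit_seqs_def)
      then show ?thesis
        using \<open>K > 0\<close> by (simp add: \<phi>_def \<psi>_def)
    qed
    ultimately show ?thesis
      by (simp add: unit_funs_def)
  qed
  have y: "y l n = (1 / K) *\<^sub>R scale (l n) (exp (c * r * of_int n) *\<^sub>R block_integral r f n)" for l n
  proof -
    let ?h = "\<lambda>v. (1 / K) *\<^sub>R scale (l n) (exp (c * r * of_int n) *\<^sub>R v)"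
    have h: "bounded_linear ?h"
      by (intro bounded_linear_intros bounded_bilinear.bounded_linear_right[OF bounded_bilinear_scale,
            THEN bounded_linear_compose])
    have "y l n = block_integral r (\<lambda>t. ?h (f t)) n"
      unfolding y_def block_integral_def
    proof (rule integral_within_block[OF \<open>0 < r\<close> order_refl order_refl])
      fix t assume "\<lfloor>t / r\<rfloor> = n"
      then show "weighted c (\<phi> l) f t = ?h (f t)"
        by (simp add: \<phi>_def \<psi>_def bounded_bilinear.scaleR_left[OF bounded_bilinear_scale]
            bounded_bilinear.scaleR_right[OF bounded_bilinear_scale] mult_exp_exp algebra_simps)
    qed
    also have "\<dots> = ?h (block_integral r f n)"
      by (rule block_integral_bounded_linear[OF h f])
    finally show ?thesis .
  qed
  have tendsto: "(\<lambda>N. \<Sum>n=- int N..<int N. y l n) \<longlonglongrightarrow> Lim at_top (sym_integral (weighted c (\<phi> l) f))"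
    if l: "l \<in> unit_seqs" for l
  proof -
    from conv[OF \<phi>[OF l]] obtain L where L: "(sym_integral (weighted c (\<phi> l) f) \<longlongrightarrow> L) at_top"
      by blast
    then have "Lim at_top (sym_integral (weighted c (\<phi> l) f)) = L"
      by (intro tendsto_Lim) auto
    moreover have "filterlim (\<lambda>N. real N * r) at_top sequentially"
      using \<open>0 < r\<close> by (intro filterlim_at_top_mult_tendsto_pos[OF tendsto_const] filterlim_real_sequentially)
    from filterlim_compose[OF L this]
    have "(\<lambda>N. sym_integral (weighted c (\<phi> l) f) (real N * r)) \<longlonglongrightarrow> L" .
    moreover have "sym_integral (weighted c (\<phi> l) f) (real N * r) = (\<Sum>n=- int N..<int N. y l n)" for N
      unfolding y_def using \<phi>[OF l] \<open>0 < r\<close>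
      by (intro sym_integral_blocks weighted_integrable f) (auto simp: unit_funs_def)
    ultimately show ?thesis
      by simp
  qed
  \<comment> \<open>Discarding the negative indices from \<open>l\<close> isolates the one term by which the sums over
    \<open>{-N..<N}\<close> and \<open>{-N..N}\<close> differ.\<close>
  define l' where "l' n = (if 0 \<le> n then l n else 0)" for n
  have "l' \<in> unit_seqs"
    using assms(4) by (auto simp: unit_seqs_def l'_def)
  note tendsto[OF this]
  from tendsto_diff[OF LIMSEQ_Suc[OF this] this]
  have "(\<lambda>N. y l' (int N) + y l' (- int N - 1)) \<longlonglongrightarrow> 0"
    unfolding sum_symmetric_int by simp
  moreover have "y l' (int N) + y l' (- int N - 1) = y l (int N)" for N
    by (simp add: y l'_def)
  ultimately have "(\<lambda>N. y l (int N)) \<longlonglongrightarrow> 0"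
    by simp
  from tendsto_scaleR[OF tendsto_const[of K] tendsto_add[OF tendsto[OF assms(4)] this]]
  have "(\<lambda>N. K *\<^sub>R sym_partial_sum (y l) N) \<longlonglongrightarrow> K *\<^sub>R Lim at_top (sym_integral (weighted c (\<phi> l) f))"
    by (simp add: sym_partial_sum_eq)
  moreover have "K *\<^sub>R sym_partial_sum (y l) N
      = sym_partial_sum (\<lambda>n. scale (l n) (exp (c * r * of_int n) *\<^sub>R block_integral r f n)) N" for N
    using \<open>K > 0\<close> by (simp add: sym_partial_sum_def y scaleR_sum_right)
  ultimately show ?thesis
    using \<phi>[OF assms(4)] by (auto simp: K_def)
qed

text \<open>A bounded multiplier is a positive multiple of one in \<open>unit_seqs\<close>, for
  which \<open>block_integrals_sum\<close> provides the limit.\<close>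

lemma block_integrals_unconditionally_convergent:
  assumes f: "locally_piecewise_continuous f"
    and conv: "\<And>\<phi>. \<phi> \<in> unit_funs \<Longrightarrow> \<exists>L. (sym_integral (weighted c \<phi> f) \<longlongrightarrow> L) at_top"
    and "0 < r"
  shows "unconditionally_convergent scale (\<lambda>n. exp (c * r * of_int n) *\<^sub>R block_integral r f n)"
  unfolding unconditionally_convergent_def
proof (intro allI impI)
  fix l :: "int \<Rightarrow> 'f" assume "bounded (range l)"
  then obtain B where "B > 0" and B: "\<And>n. norm (l n) \<le> B"
    by (auto simp: bounded_pos)
  let ?x = "\<lambda>n. exp (c * r * of_int n) *\<^sub>R block_integral r f n"
  have "(\<lambda>n. (1 / B) *\<^sub>R l n) \<in> unit_seqs"
    using B \<open>B > 0\<close> by (simp add: unit_seqs_def field_simps)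
  from block_integrals_sum[OF f conv \<open>0 < r\<close> this]
  obtain L where "sym_partial_sum (\<lambda>n. scale ((1 / B) *\<^sub>R l n) (?x n)) \<longlonglongrightarrow> L"
    by blast
  from tendsto_scaleR[OF tendsto_const[of B] this]
  have "(\<lambda>N. B *\<^sub>R sym_partial_sum (\<lambda>n. scale ((1 / B) *\<^sub>R l n) (?x n)) N) \<longlonglongrightarrow> B *\<^sub>R L" .
  moreover have "B *\<^sub>R sym_partial_sum (\<lambda>n. scale ((1 / B) *\<^sub>R l n) (?x n)) N
      = sym_partial_sum (\<lambda>n. scale (l n) (?x n)) N" for N
    using \<open>B > 0\<close>
    by (simp add: sym_partial_sum_def scaleR_sum_right bounded_bilinear.scaleR_left[OF bounded_bilinear_scale])
  ultimately show "convergent (sym_partial_sum (\<lambda>n. scale (l n) (?x n)))"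
    by (auto simp: convergent_def)
qed

text \<open>A step function is constant on each block, so only scalars have to be integrated there:
  \<open>l n\<close> is the average of \<open>\<phi>\<close> against the relative weight, divided by
  the maximum \<open>K\<close> of that weight.\<close>

lemma step_function_integral:
  assumes x: "unconditionally_convergent scale (\<lambda>n. exp (c * r * of_int n) *\<^sub>R x n)"
    and "0 < r" and \<phi>: "\<phi> \<in> unit_funs"
  shows "\<exists>l\<in>unit_seqs. (sym_integral (weighted c \<phi> (step_function r x)) \<longlongrightarrow>
    exp (max 0 c * r) *\<^sub>R lim (sym_partial_sum (\<lambda>n. scale (l n) (exp (c * r * of_int n) *\<^sub>R x n)))) at_top"
proof -
  define K where "K = exp (max 0 c * r)"
  have "K > 0"
    by (simp add: K_def)
  define x' where "x' n = exp (c * r * of_int n) *\<^sub>R x n" for n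
  define h where "h n t = (exp (c * (t - r * of_int n)) / r) *\<^sub>R \<phi> t" for n :: int and t
  define l where "l n = (1 / K) *\<^sub>R block_integral r (h n) n" for n
  define g where "g = weighted c \<phi> (step_function r x)"
  have pc: "locally_piecewise_continuous \<phi>"
    using \<phi> by (simp add: unit_funs_def)
  have "locally_piecewise_continuous (h n)" for n
    unfolding h_def
    by (intro locally_piecewise_continuous_bilinear[OF bounded_bilinear_scaleR] pc
        locally_piecewise_continuous_continuous continuous_intros) (use \<open>0 < r\<close> in auto)
  then have int_h: "h n integrable_on {a..b}" for n a b
    by (rule locally_piecewise_continuous_integrable)
  have int_g: "g integrable_on {a..b}" for a b
    unfolding g_def by (intro weighted_integrable pc locally_piecewise_continuous_step_function \<open>0 < r\<close>)
  have g: "integral {a..b} g = scale (integral {a..b} (h n)) (x' n)"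
    if "of_int n * r \<le> a" "b \<le> (of_int n + 1) * r" for n a b
  proof -
    have "integral {a..b} g = integral {a..b} (\<lambda>t. scale (h n t) (x' n))"
    proof (rule integral_within_block[OF \<open>0 < r\<close> that])
      fix t assume "\<lfloor>t / r\<rfloor> = n"
      then show "g t = scale (h n t) (x' n)"
        by (simp add: g_def h_def x'_def step_function_def bounded_bilinear.scaleR_left[OF bounded_bilinear_scale]
            bounded_bilinear.scaleR_right[OF bounded_bilinear_scale] mult_exp_exp algebra_simps
            flip: exp_add)
    qed
    also have "\<dots> = scale (integral {a..b} (h n)) (x' n)"
      using integral_linear[OF int_h bounded_bilinear.bounded_linear_left[OF bounded_bilinear_scale]]
      by (simp add: o_def)
    finally show ?thesis .
  qed
  \<comment> \<open>Needed on subintervals too: full blocks give \<open>l \<in> unit_seqs\<close>,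
    incomplete blocks give the error bound for values of \<open>R\<close> that are not multiples of
    \<open>r\<close>.\<close>
  have h: "norm (integral {a..b} (h n)) \<le> K"
    if "of_int n * r \<le> a" "a \<le> b" "b \<le> (of_int n + 1) * r" for n a b
  proof -
    have "norm (h n t) \<le> K / r" if t: "t \<in> {a..b}" for t
    proof -
      have "c * (t - r * of_int n) \<le> max 0 c * r"
        using t \<open>of_int n * r \<le> a\<close> \<open>b \<le> (of_int n + 1) * r\<close>
        by (intro mult_mono) (auto simp: algebra_simps)
      then have "exp (c * (t - r * of_int n)) * norm (\<phi> t) \<le> K * 1"
        using \<phi> by (intro mult_mono) (auto simp: K_def unit_funs_def)
      then show ?thesis
        using \<open>0 < r\<close> by (simp add: h_def divide_right_mono)
    qed
    then have "norm (integral {a..b} (h n)) \<le> K / r * measure lborel {a..b}"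
      using integrable_integral[OF int_h] \<open>K > 0\<close> \<open>0 < r\<close>
      by (intro has_integral_bound_real[of _ "{}"]) auto
    also have "\<dots> \<le> K / r * r"
      using that \<open>K > 0\<close> \<open>0 < r\<close> by (intro mult_left_mono) (auto simp: algebra_simps)
    finally show ?thesis
      using \<open>0 < r\<close> by simp
  qed
  have le: "of_int n * r \<le> (of_int n + 1) * r" for n
    using \<open>0 < r\<close> by (intro mult_right_mono) auto
  have l: "l \<in> unit_seqs"
    using h[OF order_refl le order_refl] \<open>K > 0\<close>
    by (auto simp: unit_seqs_def l_def block_integral_def divide_le_eq)
  have blocks: "block_integral r g n = K *\<^sub>R scale (l n) (x' n)" for n
    using g[OF order_refl order_refl, of n] \<open>K > 0\<close>
    by (simp add: l_def block_integral_def bounded_bilinear.scaleR_left[OF bounded_bilinear_scale])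
  have "bounded (range l)"
    using l by (auto simp: unit_seqs_def intro!: boundedI[of _ 1])
  then have "sym_partial_sum (\<lambda>n. scale (l n) (x' n)) \<longlonglongrightarrow> lim (sym_partial_sum (\<lambda>n. scale (l n) (x' n)))"
    using x by (simp add: unconditionally_convergent_def x'_def convergent_LIMSEQ_iff)
  from tendsto_scaleR[OF tendsto_const[of K] this]
  have L: "sym_partial_sum (block_integral r g) \<longlonglongrightarrow> K *\<^sub>R lim (sym_partial_sum (\<lambda>n. scale (l n) (x' n)))"
    by (simp add: sym_partial_sum_def[abs_def] blocks scaleR_sum_right)
  have "(sym_integral g \<longlongrightarrow> K *\<^sub>R lim (sym_partial_sum (\<lambda>n. scale (l n) (x' n)))) at_top"
  proof (rule sym_integral_tendsto_blocks[OF int_g \<open>0 < r\<close> _ _ _ L, where M = "\<lambda>n. K * norm (x' n)"])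
    fix n a b assume "of_int n * r \<le> a" "a \<le> b" "b \<le> (of_int n + 1) * r"
    then show "norm (integral {a..b} g) \<le> K * norm (x' n)"
      using h[of n a b] g[of n a b] by (simp add: norm_scale mult_right_mono)
  next
    show "(\<lambda>N. K * norm (x' (int N))) \<longlonglongrightarrow> 0" "(\<lambda>N. K * norm (x' (- int N - 1))) \<longlonglongrightarrow> 0"
      unfolding x'_def using unconditionally_convergent_tail[OF x]
      by (intro tendsto_mult_right_zero tendsto_norm_zero; simp)+
  qed
  with l show ?thesis
    unfolding g_def K_def x'_def by blast
qed

end

lemma cSup_le_mult:
  fixes V W :: "real set"
  assumes "V \<noteq> {}" "bdd_above W" "0 \<le> k" "\<And>v. v \<in> V \<Longrightarrow> \<exists>w\<in>W. v \<le> k * w"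
  shows "Sup V \<le> k * Sup W"
proof (rule cSup_least[OF assms(1)])
  fix v assume "v \<in> V"
  then obtain w where "w \<in> W" "v \<le> k * w"
    using assms(4) by blast
  then show "v \<le> k * Sup W"
    using cSup_upper[OF \<open>w \<in> W\<close> assms(2)] assms(3) by (meson mult_left_mono order_trans)
qed

lemma zero_in_unit_funs: "(\<lambda>t. 0) \<in> unit_funs"
  by (simp add: unit_funs_def locally_piecewise_continuous_continuous)

lemma zero_in_unit_seqs: "(\<lambda>n. 0) \<in> unit_seqs"
  by (simp add: unit_seqs_def)

section \<open>Banach couples\<close>

context banach_couple
begin

sublocale i0: Vector_Spaces.linear s0 sX i0
  by (rule linear_i0)

sublocale i1: Vector_Spaces.linear s1 sX i1
  by (rule linear_i1)

lemma subspace_couple_inter: "subspace (couple_inter i0 i1)"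
proof (rule subspaceI)
  show "c *\<^sub>R p \<in> couple_inter i0 i1" if "p \<in> couple_inter i0 i1" for c p
    using that i0.scale[of "of_real c" "fst p"] i1.scale[of "of_real c" "snd p"]
    by (simp add: couple_inter_def A0.scale_of_real A1.scale_of_real)
qed (auto simp: couple_inter_def i0.add i1.add i0.zero i1.zero)

text \<open>The set where two continuous maps into a Hausdorff space agree; this is where the
  ambient topology is needed.\<close>

lemma closed_couple_inter: "closed (couple_inter i0 i1)"
  unfolding couple_inter_def
  by (intro closed_Collect_eq continuous_on_compose2[OF continuous_i0] continuous_on_compose2[OF continuous_i1]
      continuous_intros) auto

lemma couple_sum_norm_nonneg:
  assumes "a \<in> couple_sum i0 i1"
  shows "0 \<le> couple_sum_norm i0 i1 a"
  unfolding couple_sum_norm_def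
  by (rule cInf_greatest) (use assms in \<open>auto simp: couple_sum_def\<close>)

text \<open>A triangle inequality shaped for boundary terms: one correction is measured in the first
  space, the other in the second. Membership of \<open>a\<close> makes the infimum one over a
  nonempty set.\<close>

lemma couple_sum_norm_add:
  assumes "a \<in> couple_sum i0 i1"
  shows "couple_sum_norm i0 i1 (a + i0 p + i1 q) \<le> couple_sum_norm i0 i1 a + (norm p + norm q)"
proof -
  have "couple_sum_norm i0 i1 (a + i0 p + i1 q) - (norm p + norm q) \<le> couple_sum_norm i0 i1 a"
    unfolding couple_sum_norm_def[of i0 i1 a]
  proof (rule cInf_greatest)
    show "{norm x + norm y |x y. a = i0 x + i1 y} \<noteq> {}"
      using assms by (auto simp: couple_sum_def)
    fix d assume "d \<in> {norm x + norm y |x y. a = i0 x + i1 y}"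
    then obtain x y where d: "d = norm x + norm y" and "a = i0 x + i1 y"
      by blast
    then have "a + i0 p + i1 q = i0 (x + p) + i1 (y + q)"
      by (simp add: i0.add i1.add ac_simps)
    then have "couple_sum_norm i0 i1 (a + i0 p + i1 q) \<le> norm (x + p) + norm (y + q)"
      unfolding couple_sum_norm_def by (intro cInf_lower) (auto intro!: bdd_belowI[of _ 0])
    then show "couple_sum_norm i0 i1 (a + i0 p + i1 q) - (norm p + norm q) \<le> d"
      using norm_triangle_ineq[of x p] norm_triangle_ineq[of y q] by (simp add: d)
  qed
  then show ?thesis
    by simp
qed

lemma i0_diff_in_couple_sum:
  assumes "a \<in> couple_sum i0 i1"
  shows "i0 y - a \<in> couple_sum i0 i1"
proof -
  obtain p q where "a = i0 p + i1 q"
    using assms by (auto simp: couple_sum_def)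
  then have "i0 y - a = i0 (y - p) + i1 (- q)"
    by (simp add: i0.diff i1.neg)
  then show ?thesis
    unfolding couple_sum_def by blast
qed

section \<open>The sets of values whose suprema are the norms\<close>

definition cont_values :: "real \<Rightarrow> (real \<Rightarrow> 'a \<times> 'b) \<Rightarrow> real set" where
  "cont_values \<theta> u =
     (\<lambda>\<phi>. norm (Lim at_top (sym_integral (A0.weighted (0 - \<theta>) \<phi> (\<lambda>t. fst (u t)))))) ` unit_funs \<union>
     (\<lambda>\<phi>. norm (Lim at_top (sym_integral (A1.weighted (1 - \<theta>) \<phi> (\<lambda>t. snd (u t)))))) ` unit_funs"

definition disc_values :: "real \<Rightarrow> real \<Rightarrow> (int \<Rightarrow> 'a \<times> 'b) \<Rightarrow> real set" where
  "disc_values \<theta> r a =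
     (\<lambda>l. norm (lim (sym_partial_sum
        (\<lambda>n. s0 (l n) (exp ((0 - \<theta>) * r * of_int n) *\<^sub>R fst (a n)))))) ` unit_seqs \<union>
     (\<lambda>l. norm (lim (sym_partial_sum
        (\<lambda>n. s1 (l n) (exp ((1 - \<theta>) * r * of_int n) *\<^sub>R snd (a n)))))) ` unit_seqs"

lemma J_cont_norm_eq: "J_cont_norm s0 s1 \<theta> u = Sup (cont_values \<theta> u)"
  by (simp only: J_cont_norm_def cont_values_def)

lemma J_disc_norm_eq: "J_disc_norm s0 s1 \<theta> r a = Sup (disc_values \<theta> r a)"
  by (simp only: J_disc_norm_def disc_values_def)

lemma J_contD:
  assumes "u \<in> J_cont s0 s1 i0 i1 \<theta>"
  shows "\<And>t. u t \<in> couple_inter i0 i1" "locally_piecewise_continuous u"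
    "locally_piecewise_continuous (\<lambda>t. fst (u t))" "locally_piecewise_continuous (\<lambda>t. snd (u t))"
    "\<And>\<phi>. \<phi> \<in> unit_funs \<Longrightarrow> \<exists>L. (sym_integral (A0.weighted (0 - \<theta>) \<phi> (\<lambda>t. fst (u t))) \<longlongrightarrow> L) at_top"
    "\<And>\<phi>. \<phi> \<in> unit_funs \<Longrightarrow> \<exists>L. (sym_integral (A1.weighted (1 - \<theta>) \<phi> (\<lambda>t. snd (u t))) \<longlongrightarrow> L) at_top"
proof -
  show u: "locally_piecewise_continuous u"
    using assms by (simp add: J_cont_def)
  show "locally_piecewise_continuous (\<lambda>t. fst (u t))" "locally_piecewise_continuous (\<lambda>t. snd (u t))"
    using u by (auto intro: locally_piecewise_continuous_linear bounded_linear_fst bounded_linear_snd)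
qed (use assms in \<open>unfold J_cont_def, blast+\<close>)

lemma J_discD:
  assumes "a \<in> J_disc s0 s1 i0 i1 \<theta> r"
  shows "\<And>n. a n \<in> couple_inter i0 i1"
    "unconditionally_convergent s0 (\<lambda>n. exp ((0 - \<theta>) * r * of_int n) *\<^sub>R fst (a n))"
    "unconditionally_convergent s1 (\<lambda>n. exp ((1 - \<theta>) * r * of_int n) *\<^sub>R snd (a n))"
  using assms unfolding J_disc_def by blast+

lemma bdd_above_cont_values:
  assumes "u \<in> J_cont s0 s1 i0 i1 \<theta>"
  shows "bdd_above (cont_values \<theta> u)"
proof -
  obtain B0 where B0: "\<forall>\<phi>\<in>unit_funs. norm (Lim at_top (sym_integral (A0.weighted (0 - \<theta>) \<phi> (\<lambda>t. fst (u t))))) \<le> B0"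
    using A0.weighted_integrals_bounded[OF J_contD(3,5)[OF assms]] by blast
  obtain B1 where B1: "\<forall>\<phi>\<in>unit_funs. norm (Lim at_top (sym_integral (A1.weighted (1 - \<theta>) \<phi> (\<lambda>t. snd (u t))))) \<le> B1"
    using A1.weighted_integrals_bounded[OF J_contD(4,6)[OF assms]] by blast
  show ?thesis
    unfolding cont_values_def bdd_above_Un using B0 B1 by (intro conjI bdd_above.I2) auto
qed

lemma block_integral_fst_snd:
  fixes u :: "real \<Rightarrow> 'a \<times> 'b"
  assumes "locally_piecewise_continuous u"
  shows "fst (block_integral r u n) = block_integral r (\<lambda>t. fst (u t)) n"
    "snd (block_integral r u n) = block_integral r (\<lambda>t. snd (u t)) n"
  using block_integral_bounded_linear[OF bounded_linear_fst assms]
    block_integral_bounded_linear[OF bounded_linear_snd assms] by simp_all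

lemma block_integral_in_J_disc:
  assumes u: "u \<in> J_cont s0 s1 i0 i1 \<theta>" and "0 < r"
  shows "block_integral r u \<in> J_disc s0 s1 i0 i1 \<theta> r"
proof -
  have "block_integral r u n \<in> couple_inter i0 i1" for n
    unfolding block_integral_def
    by (intro integral_in_closed_subspace subspace_couple_inter closed_couple_inter
        locally_piecewise_continuous_integrable J_contD[OF u])
  then show ?thesis
    using A0.block_integrals_unconditionally_convergent[OF J_contD(3,5)[OF u] \<open>0 < r\<close>]
      A1.block_integrals_unconditionally_convergent[OF J_contD(4,6)[OF u] \<open>0 < r\<close>]
    by (auto simp: J_disc_def block_integral_fst_snd[OF J_contD(2)[OF u]])
qed

lemma disc_values_block_integral:
  assumes u: "u \<in> J_cont s0 s1 i0 i1 \<theta>" and "0 < \<theta>" "\<theta> < 1" "0 < r"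
    and v: "v \<in> disc_values \<theta> r (block_integral r u)"
  shows "\<exists>w\<in>cont_values \<theta> u. v \<le> exp (r * \<theta>) * w"
proof -
  \<comment> \<open>The first space attains the constant; in the second the weight increases, the
    maximum is 0 and the factor is 1.\<close>
  have exp: "exp (max 0 (- (0 - \<theta>)) * r) \<le> exp (r * \<theta>)" "exp (max 0 (- (1 - \<theta>)) * r) \<le> exp (r * \<theta>)"
    using assms(2-4) by simp_all
  note fs = block_integral_fst_snd[OF J_contD(2)[OF u]]
  from v consider l where "l \<in> unit_seqs" "v = norm (lim (sym_partial_sum
        (\<lambda>n. s0 (l n) (exp ((0 - \<theta>) * r * of_int n) *\<^sub>R block_integral r (\<lambda>t. fst (u t)) n))))"
    | l where "l \<in> unit_seqs" "v = norm (lim (sym_partial_sum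
        (\<lambda>n. s1 (l n) (exp ((1 - \<theta>) * r * of_int n) *\<^sub>R block_integral r (\<lambda>t. snd (u t)) n))))"
    unfolding disc_values_def fs by blast
  then show ?thesis
  proof cases
    case 1
    obtain \<phi> where "\<phi> \<in> unit_funs" and v: "v = exp (max 0 (- (0 - \<theta>)) * r) *
        norm (Lim at_top (sym_integral (A0.weighted (0 - \<theta>) \<phi> (\<lambda>t. fst (u t)))))"
      using A0.block_integrals_sum[OF J_contD(3,5)[OF u] \<open>0 < r\<close> 1(1)] 1(2) by (auto simp: limI)
    then show ?thesis
      unfolding cont_values_def v using exp(1) by (blast intro: mult_right_mono norm_ge_zero)
  next
    case 2
    obtain \<phi> where "\<phi> \<in> unit_funs" and v: "v = exp (max 0 (- (1 - \<theta>)) * r) *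
        norm (Lim at_top (sym_integral (A1.weighted (1 - \<theta>) \<phi> (\<lambda>t. snd (u t)))))"
      using A1.block_integrals_sum[OF J_contD(4,6)[OF u] \<open>0 < r\<close> 2(1)] 2(2) by (auto simp: limI)
    then show ?thesis
      unfolding cont_values_def v using exp(2) by (blast intro: mult_right_mono norm_ge_zero)
  qed
qed

lemma step_function_fst_snd:
  fixes a :: "int \<Rightarrow> 'a \<times> 'b"
  shows "fst (step_function r a t) = step_function r (\<lambda>n. fst (a n)) t"
    "snd (step_function r a t) = step_function r (\<lambda>n. snd (a n)) t"
  by (auto simp: step_function_def)

lemma step_function_in_J_cont:
  assumes a: "a \<in> J_disc s0 s1 i0 i1 \<theta> r" and "0 < r"
  shows "step_function r a \<in> J_cont s0 s1 i0 i1 \<theta>"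
proof -
  have "step_function r a t \<in> couple_inter i0 i1" for t
    unfolding step_function_def by (rule subspace_scale[OF subspace_couple_inter J_discD(1)[OF a]])
  then have "range (step_function r a) \<subseteq> couple_inter i0 i1"
    by blast
  moreover have "\<exists>L. (sym_integral (A0.weighted (0 - \<theta>) \<phi> (\<lambda>t. fst (step_function r a t))) \<longlongrightarrow> L) at_top"
      "\<exists>L. (sym_integral (A1.weighted (1 - \<theta>) \<phi> (\<lambda>t. snd (step_function r a t))) \<longlongrightarrow> L) at_top"
    if "\<phi> \<in> unit_funs" for \<phi>
    unfolding step_function_fst_snd
    using A0.step_function_integral[OF J_discD(2)[OF a] \<open>0 < r\<close> that]
      A1.step_function_integral[OF J_discD(3)[OF a] \<open>0 < r\<close> that] by blast+
  ultimately show ?thesis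
    using locally_piecewise_continuous_step_function[OF \<open>0 < r\<close>, of a] by (simp add: J_cont_def)
qed

lemma cont_values_step_function:
  assumes a: "a \<in> J_disc s0 s1 i0 i1 \<theta> r" and "0 < \<theta>" "\<theta> < 1" "0 < r"
    and v: "v \<in> cont_values \<theta> (step_function r a)"
  shows "\<exists>w\<in>disc_values \<theta> r a. v \<le> exp ((1 - \<theta>) * r) * w"
proof -
  \<comment> \<open>Roles are exchanged: now the first space has factor 1 and the second attains the
    constant.\<close>
  have exp: "exp (max 0 (0 - \<theta>) * r) \<le> exp ((1 - \<theta>) * r)" "exp (max 0 (1 - \<theta>) * r) \<le> exp ((1 - \<theta>) * r)"
    using assms(2-4) by simp_all
  from v consider \<phi> where "\<phi> \<in> unit_funs"
      "v = norm (Lim at_top (sym_integral (A0.weighted (0 - \<theta>) \<phi> (step_function r (\<lambda>n. fst (a n))))))"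
    | \<phi> where "\<phi> \<in> unit_funs"
      "v = norm (Lim at_top (sym_integral (A1.weighted (1 - \<theta>) \<phi> (step_function r (\<lambda>n. snd (a n))))))"
    unfolding cont_values_def step_function_fst_snd by blast
  then show ?thesis
  proof cases
    case 1
    from A0.step_function_integral[OF J_discD(2)[OF a] \<open>0 < r\<close> 1(1)]
    obtain l where "l \<in> unit_seqs" and l: "(sym_integral (A0.weighted (0 - \<theta>) \<phi> (step_function r (\<lambda>n. fst (a n)))) \<longlongrightarrow>
        exp (max 0 (0 - \<theta>) * r) *\<^sub>R lim (sym_partial_sum
        (\<lambda>n. s0 (l n) (exp ((0 - \<theta>) * r * of_int n) *\<^sub>R fst (a n))))) at_top"
      by blast
    have v: "v = exp (max 0 (0 - \<theta>) * r) * norm (lim (sym_partial_sum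
        (\<lambda>n. s0 (l n) (exp ((0 - \<theta>) * r * of_int n) *\<^sub>R fst (a n)))))"
      unfolding 1(2) tendsto_Lim[OF trivial_limit_at_top_linorder l] by simp
    with \<open>l \<in> unit_seqs\<close> show ?thesis
      unfolding disc_values_def v using exp(1) by (blast intro: mult_right_mono norm_ge_zero)
  next
    case 2
    from A1.step_function_integral[OF J_discD(3)[OF a] \<open>0 < r\<close> 2(1)]
    obtain l where "l \<in> unit_seqs" and l: "(sym_integral (A1.weighted (1 - \<theta>) \<phi> (step_function r (\<lambda>n. snd (a n)))) \<longlongrightarrow>
        exp (max 0 (1 - \<theta>) * r) *\<^sub>R lim (sym_partial_sum
        (\<lambda>n. s1 (l n) (exp ((1 - \<theta>) * r * of_int n) *\<^sub>R snd (a n))))) at_top"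
      by blast
    have v: "v = exp (max 0 (1 - \<theta>) * r) * norm (lim (sym_partial_sum
        (\<lambda>n. s1 (l n) (exp ((1 - \<theta>) * r * of_int n) *\<^sub>R snd (a n)))))"
      unfolding 2(2) tendsto_Lim[OF trivial_limit_at_top_linorder l] by simp
    with \<open>l \<in> unit_seqs\<close> show ?thesis
      unfolding disc_values_def v using exp(2) by (blast intro: mult_right_mono norm_ge_zero)
  qed
qed

lemma values_nonempty: "cont_values \<theta> u \<noteq> {}" "disc_values \<theta> r a \<noteq> {}"
  using zero_in_unit_funs zero_in_unit_seqs unfolding cont_values_def disc_values_def by blast+

text \<open>No second gliding hump: \<open>a\<close> is the sequence of block integrals of its own
  step function, whose values are already known to be bounded.\<close>

lemma bdd_above_disc_values:
  assumes a: "a \<in> J_disc s0 s1 i0 i1 \<theta> r" and "0 < \<theta>" "\<theta> < 1" "0 < r"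
  shows "bdd_above (disc_values \<theta> r a)"
proof -
  have u: "step_function r a \<in> J_cont s0 s1 i0 i1 \<theta>"
    by (rule step_function_in_J_cont[OF a \<open>0 < r\<close>])
  have "v \<le> exp (r * \<theta>) * Sup (cont_values \<theta> (step_function r a))" if "v \<in> disc_values \<theta> r a" for v
  proof -
    have "v \<in> disc_values \<theta> r (block_integral r (step_function r a))"
      using that by (simp add: block_integral_step_function[OF \<open>0 < r\<close>])
    from disc_values_block_integral[OF u assms(2-4) this]
    obtain w where w: "w \<in> cont_values \<theta> (step_function r a)" "v \<le> exp (r * \<theta>) * w"
      by blast
    note w(2)
    also have "exp (r * \<theta>) * w \<le> exp (r * \<theta>) * Sup (cont_values \<theta> (step_function r a))"
      using cSup_upper[OF w(1) bdd_above_cont_values[OF u]] by simp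
    finally show ?thesis .
  qed
  then show ?thesis
    by (rule bdd_aboveI)
qed

text \<open>Provides the lower bound 0 that makes the infimum defining the interpolation norm
  meaningful; the supremum dominates its members only because it is bounded.\<close>

lemma J_cont_norm_nonneg:
  assumes "u \<in> J_cont s0 s1 i0 i1 \<theta>"
  shows "0 \<le> J_cont_norm s0 s1 \<theta> u"
proof -
  obtain v where v: "v \<in> cont_values \<theta> u"
    using values_nonempty(1) by blast
  then have "0 \<le> v"
    by (auto simp: cont_values_def)
  also have "v \<le> Sup (cont_values \<theta> u)"
    by (rule cSup_upper[OF v bdd_above_cont_values[OF assms]])
  finally show ?thesis
    by (simp only: J_cont_norm_eq)
qed

lemma J_disc_norm_nonneg:
  assumes "a \<in> J_disc s0 s1 i0 i1 \<theta> r" "0 < \<theta>" "\<theta> < 1" "0 < r"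
  shows "0 \<le> J_disc_norm s0 s1 \<theta> r a"
proof -
  obtain v where v: "v \<in> disc_values \<theta> r a"
    using values_nonempty(2) by blast
  then have "0 \<le> v"
    by (auto simp: disc_values_def)
  also have "v \<le> Sup (disc_values \<theta> r a)"
    by (rule cSup_upper[OF v bdd_above_disc_values[OF assms]])
  finally show ?thesis
    by (simp only: J_disc_norm_eq)
qed

lemma J_disc_norm_block_integral:
  assumes "u \<in> J_cont s0 s1 i0 i1 \<theta>" "0 < \<theta>" "\<theta> < 1" "0 < r"
  shows "J_disc_norm s0 s1 \<theta> r (block_integral r u) \<le> exp (r * \<theta>) * J_cont_norm s0 s1 \<theta> u"
  unfolding J_disc_norm_eq J_cont_norm_eq
  by (rule cSup_le_mult[OF values_nonempty(2) bdd_above_cont_values[OF assms(1)]])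
    (use disc_values_block_integral[OF assms] in auto)

lemma J_cont_norm_step_function:
  assumes "a \<in> J_disc s0 s1 i0 i1 \<theta> r" "0 < \<theta>" "\<theta> < 1" "0 < r"
  shows "J_cont_norm s0 s1 \<theta> (step_function r a) \<le> exp ((1 - \<theta>) * r) * J_disc_norm s0 s1 \<theta> r a"
  unfolding J_disc_norm_eq J_cont_norm_eq
  by (rule cSup_le_mult[OF values_nonempty(1) bdd_above_disc_values[OF assms]])
    (use cont_values_step_function[OF assms] in auto)

section \<open>Boundary terms and representations of an element\<close>

lemma J_disc_tails:
  assumes a: "a \<in> J_disc s0 s1 i0 i1 \<theta> r" and "0 < \<theta>" "\<theta> < 1" "0 < r"
  shows "(\<lambda>N. fst (a (- int N - 1))) \<longlonglongrightarrow> 0" "(\<lambda>N. snd (a (int N))) \<longlonglongrightarrow> 0"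
proof -
  have le: "norm x \<le> norm (exp k *\<^sub>R x)" if "0 \<le> k" for k and x :: "'c::real_normed_vector"
    using that mult_right_mono[of 1 "exp k" "norm x"] by simp
  have "(0 - \<theta>) * r * of_int (- int N - 1) = \<theta> * r * (real N + 1)" for N
    by (simp add: algebra_simps)
  then have "0 \<le> (0 - \<theta>) * r * of_int (- int N - 1)" for N
    using assms(2,4) by simp
  then show "(\<lambda>N. fst (a (- int N - 1))) \<longlonglongrightarrow> 0"
    by (intro Lim_null_comparison[OF always_eventually
          tendsto_norm_zero[OF A0.unconditionally_convergent_tail(2)[OF J_discD(2)[OF a]]]] allI le)
  have "0 \<le> (1 - \<theta>) * r * of_int (int N)" for N
    using assms(3,4) by simp
  then show "(\<lambda>N. snd (a (int N))) \<longlonglongrightarrow> 0"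
    by (intro Lim_null_comparison[OF always_eventually
          tendsto_norm_zero[OF A1.unconditionally_convergent_tail(1)[OF J_discD(3)[OF a]]]] allI le)
qed

lemma disc_rep_block_integral:
  assumes u: "u \<in> J_cont s0 s1 i0 i1 \<theta>" and "0 < \<theta>" "\<theta> < 1" "0 < r" and x: "cont_rep i0 i1 u x"
  shows "disc_rep i0 i1 (block_integral r u) x"
proof -
  define a where "a = block_integral r u"
  have a: "a \<in> J_disc s0 s1 i0 i1 \<theta> r"
    unfolding a_def by (rule block_integral_in_J_disc[OF u \<open>0 < r\<close>])
  have x_sum: "x \<in> couple_sum i0 i1"
    using x by (simp add: cont_rep_def)
  \<comment> \<open>Comparing with \<open>Suc N\<close> instead of \<open>N\<close> puts the surplus
    block at the negative end, where it tends to 0 in the first space and no change of component is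
    needed.\<close>
  have S: "sym_partial_sum a N = sym_integral u (real (Suc N) * r) - a (- int N - 1)" for N
  proof -
    have "sym_integral u (real (Suc N) * r) = (\<Sum>n=- int (Suc N)..<int (Suc N). a n)"
      unfolding a_def using locally_piecewise_continuous_integrable[OF J_contD(2)[OF u]] \<open>0 < r\<close>
      by (intro sym_integral_blocks) auto
    then show ?thesis
      unfolding sym_partial_sum_eq sum_symmetric_int by simp
  qed
  have "(\<lambda>N. couple_sum_norm i0 i1 (i0 (fst (sym_partial_sum a N)) - x)) \<longlonglongrightarrow> 0"
  proof (rule tendsto_sandwich[OF _ _ tendsto_const])
    have "filterlim (\<lambda>N. real (Suc N) * r) at_top sequentially"
      using \<open>0 < r\<close>
      by (intro filterlim_at_top_mult_tendsto_pos[OF tendsto_const]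
          filterlim_compose[OF filterlim_real_sequentially filterlim_Suc])
    from tendsto_add[OF filterlim_compose[OF _ this] tendsto_norm_zero[OF J_disc_tails(1)[OF a assms(2-4)]]] x
    show "(\<lambda>N. couple_sum_norm i0 i1 (i0 (fst (sym_integral u (real (Suc N) * r))) - x)
        + norm (fst (a (- int N - 1)))) \<longlonglongrightarrow> 0"
      unfolding cont_rep_def by force
    have "couple_sum_norm i0 i1 (i0 (fst (sym_partial_sum a N)) - x)
        \<le> couple_sum_norm i0 i1 (i0 (fst (sym_integral u (real (Suc N) * r))) - x) + norm (fst (a (- int N - 1)))" for N
      using couple_sum_norm_add[OF i0_diff_in_couple_sum[OF x_sum], of "fst (sym_integral u (real (Suc N) * r))"
          "- fst (a (- int N - 1))" 0]
      by (simp add: S i0.diff i0.neg i1.zero algebra_simps)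
    then show "\<forall>\<^sub>F N in sequentially. couple_sum_norm i0 i1 (i0 (fst (sym_partial_sum a N)) - x)
        \<le> couple_sum_norm i0 i1 (i0 (fst (sym_integral u (real (Suc N) * r))) - x) + norm (fst (a (- int N - 1)))"
      by (intro always_eventually allI)
  qed (intro always_eventually allI couple_sum_norm_nonneg i0_diff_in_couple_sum x_sum)
  with x_sum show ?thesis
    by (simp add: disc_rep_def a_def)
qed

lemma cont_rep_step_function:
  assumes a: "a \<in> J_disc s0 s1 i0 i1 \<theta> r" and "0 < \<theta>" "\<theta> < 1" "0 < r" and x: "disc_rep i0 i1 a x"
  shows "cont_rep i0 i1 (step_function r a) x"
proof -
  define u where "u = step_function r a"
  define N where "N R = nat \<lfloor>R / r\<rfloor>" for R
  have N: "filterlim N sequentially at_top"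
    unfolding N_def by (rule filterlim_nat_floor_divide[OF \<open>0 < r\<close>])
  have x_sum: "x \<in> couple_sum i0 i1"
    using x by (simp add: disc_rep_def)
  have "((\<lambda>R. couple_sum_norm i0 i1 (i0 (fst (sym_integral u R)) - x)) \<longlongrightarrow> 0) at_top"
  proof (rule tendsto_sandwich[OF _ _ tendsto_const])
    have "(\<lambda>n. couple_sum_norm i0 i1 (i0 (fst (sym_partial_sum a n)) - x)
        + (norm (fst (a (- int n - 1))) + norm (snd (a (int n))))) \<longlonglongrightarrow> 0 + (0 + 0)"
      using x unfolding disc_rep_def
      by (intro tendsto_add tendsto_norm_zero J_disc_tails[OF a assms(2-4)]) auto
    from filterlim_compose[OF this N]
    show "((\<lambda>R. couple_sum_norm i0 i1 (i0 (fst (sym_partial_sum a (N R))) - x)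
        + (norm (fst (a (- int (N R) - 1))) + norm (snd (a (int (N R)))))) \<longlongrightarrow> 0) at_top"
      by simp
    have "couple_sum_norm i0 i1 (i0 (fst (sym_integral u R)) - x)
        \<le> couple_sum_norm i0 i1 (i0 (fst (sym_partial_sum a (N R))) - x)
          + (norm (fst (a (- int (N R) - 1))) + norm (snd (a (int (N R)))))" if "0 \<le> R" for R
    proof -
      define n where "n = N R"
      have n: "real n * r \<le> R" "R \<le> (real n + 1) * r"
        unfolding n_def N_def using nat_floor_divide_bounds[OF \<open>0 < r\<close> that] by auto
      \<comment> \<open>The fraction of block \<open>n\<close> beyond \<open>R\<close> and the
        fraction of block \<open>- n - 1\<close> inside [-R, R]; integrals of the step function over
        these pieces are such fractions of its terms.\<close>
      define \<sigma> \<tau> where "\<sigma> = ((real n + 1) * r - R) / r" and "\<tau> = (R - real n * r) / r"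
      have \<sigma>\<tau>: "0 \<le> \<sigma>" "\<sigma> \<le> 1" "0 \<le> \<tau>" "\<tau> \<le> 1"
        using n \<open>0 < r\<close> by (simp_all add: \<sigma>_def \<tau>_def field_simps)
      have "integral {R..(real n + 1) * r} u = \<sigma> *\<^sub>R a (int n)"
        using n integral_step_function[OF \<open>0 < r\<close>, of "int n" R "(real n + 1) * r" a]
        by (simp add: u_def \<sigma>_def)
      moreover have "integral {- R..- (real n * r)} u = \<tau> *\<^sub>R a (- int n - 1)"
        using n integral_step_function[OF \<open>0 < r\<close>, of "- int n - 1" "- R" "- (real n * r)" a]
        by (simp add: u_def \<tau>_def algebra_simps)
      ultimately have "sym_integral u R = sym_partial_sum a n - \<sigma> *\<^sub>R a (int n) + \<tau> *\<^sub>R a (- int n - 1)"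
        using sym_integral_decompose[OF locally_piecewise_continuous_integrable, of u r n R]
          locally_piecewise_continuous_step_function[OF \<open>0 < r\<close>, of a] n \<open>0 < r\<close>
        by (simp add: u_def block_integral_step_function)
      \<comment> \<open>The term at the positive end is moved to the second space, since only its
        second component is known to tend to 0.\<close>
      moreover have "i0 (fst (\<sigma> *\<^sub>R a (int n))) = i1 (snd (\<sigma> *\<^sub>R a (int n)))"
        using subspace_scale[OF subspace_couple_inter J_discD(1)[OF a]] by (auto simp: couple_inter_def)
      ultimately have "i0 (fst (sym_integral u R)) - x = (i0 (fst (sym_partial_sum a n)) - x)
          + i0 (\<tau> *\<^sub>R fst (a (- int n - 1))) + i1 (- (\<sigma> *\<^sub>R snd (a (int n))))"
        by (simp add: i0.add i0.diff i1.neg)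
      from this couple_sum_norm_add[OF i0_diff_in_couple_sum[OF x_sum]]
      have "couple_sum_norm i0 i1 (i0 (fst (sym_integral u R)) - x)
          \<le> couple_sum_norm i0 i1 (i0 (fst (sym_partial_sum a n)) - x)
            + (norm (\<tau> *\<^sub>R fst (a (- int n - 1))) + norm (- (\<sigma> *\<^sub>R snd (a (int n)))))"
        by (simp only:)
      moreover have "norm (\<tau> *\<^sub>R fst (a (- int n - 1))) \<le> norm (fst (a (- int n - 1)))"
        "norm (- (\<sigma> *\<^sub>R snd (a (int n)))) \<le> norm (snd (a (int n)))"
        using \<sigma>\<tau> by (simp_all add: mult_left_le_one_le)
      ultimately show ?thesis
        unfolding n_def[symmetric] by linarith
    qed
    then show "\<forall>\<^sub>F R in at_top. couple_sum_norm i0 i1 (i0 (fst (sym_integral u R)) - x)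
        \<le> couple_sum_norm i0 i1 (i0 (fst (sym_partial_sum a (N R))) - x)
          + (norm (fst (a (- int (N R) - 1))) + norm (snd (a (int (N R)))))"
      by (rule eventually_at_top_linorderI)
  qed (intro always_eventually allI couple_sum_norm_nonneg i0_diff_in_couple_sum x_sum)
  with x_sum show ?thesis
    by (simp add: cont_rep_def u_def)
qed

section \<open>Comparison of the interpolation spaces and their norms\<close>

lemma interp_disc_eq_interp_cont:
  assumes "0 < \<theta>" "\<theta> < 1" "0 < r"
  shows "interp_disc s0 s1 i0 i1 \<theta> r = interp_cont s0 s1 i0 i1 \<theta>"
proof (intro equalityI subsetI)
  fix x assume "x \<in> interp_disc s0 s1 i0 i1 \<theta> r"
  then obtain a where a: "a \<in> J_disc s0 s1 i0 i1 \<theta> r" "disc_rep i0 i1 a x"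
    unfolding interp_disc_def by blast
  show "x \<in> interp_cont s0 s1 i0 i1 \<theta>"
    unfolding interp_cont_def
    using step_function_in_J_cont[OF a(1) assms(3)] cont_rep_step_function[OF a(1) assms a(2)] by blast
next
  fix x assume "x \<in> interp_cont s0 s1 i0 i1 \<theta>"
  then obtain u where u: "u \<in> J_cont s0 s1 i0 i1 \<theta>" "cont_rep i0 i1 u x"
    unfolding interp_cont_def by blast
  show "x \<in> interp_disc s0 s1 i0 i1 \<theta> r"
    unfolding interp_disc_def
    using block_integral_in_J_disc[OF u(1) assms(3)] disc_rep_block_integral[OF u(1) assms u(2)] by blast
qed

lemma interp_disc_norm_le:
  assumes "x \<in> interp_cont s0 s1 i0 i1 \<theta>" "0 < \<theta>" "\<theta> < 1" "0 < r"
  shows "exp (- r * \<theta>) * interp_disc_norm s0 s1 i0 i1 \<theta> r x \<le> interp_cont_norm s0 s1 i0 i1 \<theta> x"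
  unfolding interp_cont_norm_def
proof (rule cInf_greatest)
  show "{J_cont_norm s0 s1 \<theta> u |u. u \<in> J_cont s0 s1 i0 i1 \<theta> \<and> cont_rep i0 i1 u x} \<noteq> {}"
    using assms(1) unfolding interp_cont_def by blast
  fix k assume "k \<in> {J_cont_norm s0 s1 \<theta> u |u. u \<in> J_cont s0 s1 i0 i1 \<theta> \<and> cont_rep i0 i1 u x}"
  then obtain u where k: "k = J_cont_norm s0 s1 \<theta> u" and u: "u \<in> J_cont s0 s1 i0 i1 \<theta>" "cont_rep i0 i1 u x"
    by blast
  have "interp_disc_norm s0 s1 i0 i1 \<theta> r x \<le> J_disc_norm s0 s1 \<theta> r (block_integral r u)"
    unfolding interp_disc_norm_def
  proof (rule cInf_lower)
    show "J_disc_norm s0 s1 \<theta> r (block_integral r u)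
        \<in> {J_disc_norm s0 s1 \<theta> r a |a. a \<in> J_disc s0 s1 i0 i1 \<theta> r \<and> disc_rep i0 i1 a x}"
      using block_integral_in_J_disc[OF u(1) assms(4)] disc_rep_block_integral[OF u(1) assms(2-4) u(2)] by blast
    show "bdd_below {J_disc_norm s0 s1 \<theta> r a |a. a \<in> J_disc s0 s1 i0 i1 \<theta> r \<and> disc_rep i0 i1 a x}"
      using J_disc_norm_nonneg[OF _ assms(2-4)] by (intro bdd_belowI[of _ 0]) blast
  qed
  also have "\<dots> \<le> exp (r * \<theta>) * k"
    unfolding k by (rule J_disc_norm_block_integral[OF u(1) assms(2-4)])
  finally show "exp (- r * \<theta>) * interp_disc_norm s0 s1 i0 i1 \<theta> r x \<le> k"
    by (simp add: exp_minus field_simps)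
qed

lemma interp_cont_norm_le:
  assumes "x \<in> interp_disc s0 s1 i0 i1 \<theta> r" "0 < \<theta>" "\<theta> < 1" "0 < r"
  shows "interp_cont_norm s0 s1 i0 i1 \<theta> x \<le> exp ((1 - \<theta>) * r) * interp_disc_norm s0 s1 i0 i1 \<theta> r x"
proof -
  \<comment> \<open>Dividing by the constant leaves a bare infimum on the right, so that it suffices
    to compare with each representation.\<close>
  have "interp_cont_norm s0 s1 i0 i1 \<theta> x / exp ((1 - \<theta>) * r) \<le> interp_disc_norm s0 s1 i0 i1 \<theta> r x"
    unfolding interp_disc_norm_def
  proof (rule cInf_greatest)
    show "{J_disc_norm s0 s1 \<theta> r a |a. a \<in> J_disc s0 s1 i0 i1 \<theta> r \<and> disc_rep i0 i1 a x} \<noteq> {}"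
      using assms(1) unfolding interp_disc_def by blast
    fix k assume "k \<in> {J_disc_norm s0 s1 \<theta> r a |a. a \<in> J_disc s0 s1 i0 i1 \<theta> r \<and> disc_rep i0 i1 a x}"
    then obtain a where k: "k = J_disc_norm s0 s1 \<theta> r a" and a: "a \<in> J_disc s0 s1 i0 i1 \<theta> r" "disc_rep i0 i1 a x"
      by blast
    have "interp_cont_norm s0 s1 i0 i1 \<theta> x \<le> J_cont_norm s0 s1 \<theta> (step_function r a)"
      unfolding interp_cont_norm_def
    proof (rule cInf_lower)
      show "J_cont_norm s0 s1 \<theta> (step_function r a)
          \<in> {J_cont_norm s0 s1 \<theta> u |u. u \<in> J_cont s0 s1 i0 i1 \<theta> \<and> cont_rep i0 i1 u x}"
        using step_function_in_J_cont[OF a(1) assms(4)] cont_rep_step_function[OF a(1) assms(2-4) a(2)] by blast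
      show "bdd_below {J_cont_norm s0 s1 \<theta> u |u. u \<in> J_cont s0 s1 i0 i1 \<theta> \<and> cont_rep i0 i1 u x}"
        using J_cont_norm_nonneg by (intro bdd_belowI[of _ 0]) blast
    qed
    also have "\<dots> \<le> exp ((1 - \<theta>) * r) * k"
      unfolding k by (rule J_cont_norm_step_function[OF a(1) assms(2-4)])
    finally show "interp_cont_norm s0 s1 i0 i1 \<theta> x / exp ((1 - \<theta>) * r) \<le> k"
      by (simp add: field_simps)
  qed
  then show ?thesis
    by (simp add: field_simps)
qed

end

theorem theorem3p6:
  fixes s0 :: "'f::real_or_complex \<Rightarrow> 'a::banach \<Rightarrow> 'a"
    and s1 :: "'f \<Rightarrow> 'b::banach \<Rightarrow> 'b"
    and sX :: "'f \<Rightarrow> 'x::{topological_ab_group_add, t2_space} \<Rightarrow> 'x"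
    and i0 :: "'a \<Rightarrow> 'x"
    and i1 :: "'b \<Rightarrow> 'x"
    and \<theta> r :: real
  assumes "banach_couple s0 s1 sX i0 i1"
    and "0 < \<theta>" "\<theta> < 1" "0 < r"
  shows "interp_disc s0 s1 i0 i1 \<theta> r = interp_cont s0 s1 i0 i1 \<theta> \<and>
    (\<forall>a \<in> interp_cont s0 s1 i0 i1 \<theta>.
       exp (- r * \<theta>) * interp_disc_norm s0 s1 i0 i1 \<theta> r a \<le> interp_cont_norm s0 s1 i0 i1 \<theta> a \<and>
       interp_cont_norm s0 s1 i0 i1 \<theta> a \<le> exp ((1 - \<theta>) * r) * interp_disc_norm s0 s1 i0 i1 \<theta> r a)"
  by (intro conjI ballI banach_couple.interp_disc_eq_interp_cont[OF assms]
      banach_couple.interp_disc_norm_le[OF assms(1) _ assms(2-4)]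
      banach_couple.interp_cont_norm_le[OF assms(1) _ assms(2-4)])
    (simp_all add: banach_couple.interp_disc_eq_interp_cont[OF assms])

end
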